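(* Let $N\ge 2$ and $g\ge1$ be integers, and let $A\in\mathcal{P}(\mathbb{T},\mathrm{U}(N))$, $A(z)=A^{(0)}+zA^{(1)}+\cdots+z^{g-1}A^{(g-1)}$. Then the following five conditions are equivalent. (i) $\lambda_0(A)=1$, where $\lambda_0(A)$ is the $(0,0)$ matrix entry of $A^{(0)*}A^{(0)}$. (ii) There is a $B=(B_{i,j})_{i,j=1}^{N-1}\in\mathcal{P}(\mathbb{T},\mathrm{U}(N-1))$ such that $$A(1)^{-1}A(z)=\begin{pmatrix}1&0\\0&B(z)\end{pmatrix}=(1)\oplus B(z)\qquad(z\in\mathbb{T}).$$ (iii) After modification with a $\mathrm{U}(N)$-automorphism of $\mathcal{O}_N$, the wavelet filter has the following form: there exist $W\in\mathrm{U}(N)$ and $B=(B_{i,j})_{i,j=1}^{N-1}\in\mathcal{P}(\mathbb{T},\mathrm{U}(N-1))$ such that the modified filter functions $m_i=\sum_{j=0}^{N-1}W_{i,j}m_j^{(A)}$ satisfy $m_0(z)=1$ for all $z\in\mathbb{T}$ and $m_i(z)=\sum_{j=1}^{N-1}B_{i,j}(z^N)z^j$ for $1\le i\le N-1$. (iv) $T_i^{(A)*}e_0\in\mathbb{C}e_0$ for all $i=0,\ldots,N-1$. (v) $\sigma_{\mathcal{K}}^{(A)*}(E_{0,0})\in\mathbb{C}E_{0,0}$.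
   Context: $\mathbb{T}=\{z\in\mathbb{C}:|z|=1\}$ with normalized Haar measure. $\mathcal{P}(\mathbb{T},\mathrm{U}(N))$ is the set of polynomial loops: maps $A\colon\mathbb{T}\to\mathrm{U}(N)$ ($\mathrm{U}(N)$ = unitary $N\times N$ matrices) whose matrix entries are polynomials in $z$. Matrix indices for $A$ run over $0,\dots,N-1$. The wavelet filter of $A=(A_{i,j})$ is $m_i^{(A)}(z)=\sum_{j=0}^{N-1}z^jA_{i,j}(z^N)$, $0\le i<N$, and $(T_i^{(A)}\xi)(z)=m_i^{(A)}(z)\xi(z^N)$ for $\xi\in L^2(\mathbb{T})$. The isometries $T_i^{(A)}$ satisfy the Cuntz relations $T_i^{(A)*}T_j^{(A)}=\delta_{i,j}\mathbf{1}$, $\sum_iT_i^{(A)}T_i^{(A)*}=\mathbf{1}$, i.e. give a representation of the Cuntz algebra $\mathcal{O}_N$. (A $\mathrm{U}(N)$-automorphism of $\mathcal{O}_N$ replaces the generators by unitary linear combinations of them; on filters this replaces $m_i^{(A)}$ by $\sum_jW_{i,j}m_j^{(A)}$ with $W\in\mathrm{U}(N)$, equivalently replaces $A$ by $WA$.) Put $e_n(z)=z^n$, $n\in\mathbb{Z}$; $r=g+\lfloor\frac{g-1}{N-1}\rfloor$; and $\mathcal{K}=\operatorname{span}\{e_0,e_{-1},\dots,e_{-r}\}\subset L^2(\mathbb{T})$, which is invariant under all $T_i^{(A)*}$. Let $P_{\mathcal{K}}$ be the orthogonal projection onto $\mathcal{K}$ and $V_i^{(A)}=P_{\mathcal{K}}T_i^{(A)}|_{\mathcal{K}}\in\mathcal{B}(\mathcal{K})$,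 so $V_i^{(A)*}=T_i^{(A)*}|_{\mathcal{K}}$. Let $\sigma_{\mathcal{K}}^{(A)}(X)=\sum_{i=0}^{N-1}V_i^{(A)}XV_i^{(A)*}$ for $X\in\mathcal{B}(\mathcal{K})$, and let $\sigma_{\mathcal{K}}^{(A)*}$ be its adjoint with respect to the Hilbert–Schmidt inner product on $\mathcal{B}(\mathcal{K})$, i.e. $\sigma_{\mathcal{K}}^{(A)*}(X)=\sum_{i=0}^{N-1}V_i^{(A)*}XV_i^{(A)}$. $E_{0,0}\in\mathcal{B}(\mathcal{K})$ is the rank-one orthogonal projection onto $\mathbb{C}e_0$. *)

theory Defs
  imports "HOL-Analysis.Analysis" "Jordan_Normal_Form.Schur_Decomposition"
    "Jordan_Normal_Form.Gauss_Jordan_Elimination"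
begin

abbreviation circle :: "complex set" where
  "circle \<equiv> sphere 0 1"

definition unitary_group :: "nat \<Rightarrow> complex mat set" where
  "unitary_group n = {U \<in> carrier_mat n n.
     mat_adjoint U * U = 1\<^sub>m n \<and> U * mat_adjoint U = 1\<^sub>m n}"

text \<open>Loops are total functions on the complex numbers; only their values on the unit circle
  matter.\<close>

definition poly_loops :: "nat \<Rightarrow> (complex \<Rightarrow> complex mat) set" where
  "poly_loops n = {A. (\<forall>z\<in>circle. A z \<in> unitary_group n) \<and>
     (\<forall>i<n. \<forall>j<n. \<exists>p :: complex poly. \<forall>z\<in>circle. A z $$ (i, j) = poly p z)}"

definition wavelet_filter ::
    "nat \<Rightarrow> (complex \<Rightarrow> complex mat) \<Rightarrow> nat \<Rightarrow> complex \<Rightarrow> complex" where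
  "wavelet_filter N A i z = (\<Sum>j<N. z ^ j * A (z ^ N) $$ (i, j))"

text \<open>Normalized Haar measure: the image of the uniform distribution on the unit interval under
  \<open>t \<mapsto> exp (2 \<pi> i t)\<close>. Its underlying space is the circle itself.\<close>

definition haar :: "complex measure" where
  "haar = distr (uniform_measure lborel {0..1}) (restrict_space borel circle)
     (\<lambda>t::real. cis (2 * pi * t))"

lemma space_haar [simp]: "space haar = circle"
  by (simp add: haar_def space_restrict_space)

lemma measurable_cis_circle:
  "(\<lambda>t::real. cis (2 * pi * t)) \<in> uniform_measure lborel {0..1} \<rightarrow>\<^sub>M restrict_space borel circle"
  by (intro measurable_restrict_space2) (auto simp: cis_conv_exp)

lemma emeasure_haar_circle: "emeasure haar circle = 1"
proof -
  have circle_sets: "circle \<in> sets (restrict_space borel circle)"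
    by (metis sets.top space_restrict_space space_borel Int_UNIV_right)
  have "(\<lambda>t::real. cis (2 * pi * t)) -` circle = UNIV"
    by auto
  moreover have "emeasure (uniform_measure lborel {0..1::real}) UNIV = 1"
    by (subst emeasure_uniform_measure) auto
  ultimately show ?thesis
    unfolding haar_def
    by (subst emeasure_distr[OF measurable_cis_circle circle_sets]) simp
qed

text \<open>Elements of \<open>L\<^sup>2\<close> of the circle are represented by square-integrable functions; equality in
  \<open>L\<^sup>2\<close> is equality almost everywhere.\<close>

definition L2 :: "(complex \<Rightarrow> complex) set" where
  "L2 = {f \<in> borel_measurable haar. integrable haar (\<lambda>z. (cmod (f z))\<^sup>2)}"

definition ip :: "(complex \<Rightarrow> complex) \<Rightarrow> (complex \<Rightarrow> complex) \<Rightarrow> complex" where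
  "ip f g = (LINT z|haar. f z * cnj (g z))"

definition L2_eq :: "(complex \<Rightarrow> complex) \<Rightarrow> (complex \<Rightarrow> complex) \<Rightarrow> bool" where
  "L2_eq f g \<longleftrightarrow> (AE z in haar. f z = g z)"

definition e_fun :: "int \<Rightarrow> complex \<Rightarrow> complex" where
  "e_fun n z = z powi n"

definition span_e :: "int set \<Rightarrow> (complex \<Rightarrow> complex) set" where
  "span_e I = {f. \<exists>c :: int \<Rightarrow> complex. f = (\<lambda>z. \<Sum>n\<in>I. c n * e_fun n z)}"

text \<open>Adjoint of an operator \<open>S\<close> on the Hilbert space \<open>H\<close> and orthogonal projection onto the
  closed subspace \<open>H\<close>. The chosen element is unique up to equality almost everywhere.\<close>

definition adj_on ::
    "(complex \<Rightarrow> complex) set \<Rightarrow> ((complex \<Rightarrow> complex) \<Rightarrow> complex \<Rightarrow> complex) \<Rightarrow>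
     (complex \<Rightarrow> complex) \<Rightarrow> complex \<Rightarrow> complex" where
  "adj_on H S f = (SOME g. g \<in> H \<and> (\<forall>h\<in>H. ip (S h) f = ip h g))"

definition proj_on ::
    "(complex \<Rightarrow> complex) set \<Rightarrow> (complex \<Rightarrow> complex) \<Rightarrow> complex \<Rightarrow> complex" where
  "proj_on H f = (SOME g. g \<in> H \<and> (\<forall>h\<in>H. ip (\<lambda>z. f z - g z) h = 0))"

definition T_op ::
    "nat \<Rightarrow> (complex \<Rightarrow> complex mat) \<Rightarrow> nat \<Rightarrow> (complex \<Rightarrow> complex) \<Rightarrow> complex \<Rightarrow> complex" where
  "T_op N A i \<xi> = (\<lambda>z. wavelet_filter N A i z * \<xi> (z ^ N))"

definition K_space :: "nat \<Rightarrow> nat \<Rightarrow> (complex \<Rightarrow> complex) set" where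
  "K_space N g = span_e {- int (g + (g - 1) div (N - 1))..0}"

text \<open>Operators on \<open>K_space N g\<close> are functions of which only the restriction to that space
  matters.\<close>

definition V_op ::
    "nat \<Rightarrow> nat \<Rightarrow> (complex \<Rightarrow> complex mat) \<Rightarrow> nat \<Rightarrow> (complex \<Rightarrow> complex) \<Rightarrow> complex \<Rightarrow> complex" where
  "V_op N g A i \<xi> = proj_on (K_space N g) (T_op N A i \<xi>)"

definition E00 :: "(complex \<Rightarrow> complex) \<Rightarrow> complex \<Rightarrow> complex" where
  "E00 = proj_on (span_e {0})"

definition sigma_adj ::
    "nat \<Rightarrow> nat \<Rightarrow> (complex \<Rightarrow> complex mat) \<Rightarrow>
     ((complex \<Rightarrow> complex) \<Rightarrow> complex \<Rightarrow> complex) \<Rightarrow> (complex \<Rightarrow> complex) \<Rightarrow> complex \<Rightarrow> complex" where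
  "sigma_adj N g A X \<xi> =
     (\<lambda>z. \<Sum>i<N. adj_on (K_space N g) (V_op N g A i) (X (V_op N g A i \<xi>)) z)"

end

theory Submission
  imports Defs
begin

text \<open>All five conditions say that the first column of \<open>A(z)\<close> does not depend on \<open>z\<close>. Since
  \<open>z\<^sup>j F(z\<^sup>N)\<close> integrates to \<open>\<integral> F\<close> for \<open>j = 0\<close> and to \<open>0\<close> for \<open>0 < j < N\<close>, the function
  \<open>T\<^sub>i\<^sup>* e\<^sub>0\<close> is \<open>u\<^sub>i = cnj A\<^sub>i\<^sub>0\<close>, which gives (iv); and \<open>\<sigma>\<^sup>*(E\<^sub>0\<^sub>0)\<close> maps \<open>\<xi>\<close> to
  \<open>\<Sum>\<^sub>i \<langle>\<xi>, u\<^sub>i\<rangle> u\<^sub>i\<close>, so testing it on \<open>e\<^sub>-\<^sub>k\<close> with \<open>0 < k < g\<close> gives (v). For (i), the first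
  column is a unit vector at every point of the circle, so by Parseval its coefficients have total
  square norm \<open>1\<close>. Finally a unitary matrix whose first column is the first unit vector splits as
  \<open>1 \<oplus> B\<close>, which gives (ii) with \<open>W = A(1)\<^sup>-\<^sup>1\<close> in (iii), and averaging a filter over the
  \<open>N\<close>-th roots of a point recovers the first column from (iii).\<close>

section \<open>Integration against Haar measure\<close>

lemma circle_nth_root:
  fixes z :: complex
  assumes "N > 0" "z \<in> circle"
  obtains y where "y \<in> circle" "y ^ N = z"
proof -
  have z: "z = cis (Arg z)"
    using assms cis_Arg[of z] by (metis mem_sphere dist_0_norm norm_zero sgn_div_norm scaleR_one inverse_1 zero_neq_one)
  have "cis (Arg z / real N) ^ N = cis (Arg z)"
    using assms by (simp add: Complex.DeMoivre)
  then show thesis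
    using z by (intro that[of "cis (Arg z / real N)"]) auto
qed

lemma measurable_haar_iff:
  "f \<in> borel_measurable haar \<longleftrightarrow> f \<in> borel_measurable (restrict_space borel circle)"
  by (simp add: haar_def)

text \<open>Parametrization by one period turns Haar integrals into Lebesgue integrals. Dropping the
  null endpoint 1 makes the interval half-open, so that \<open>N\<close> disjoint subintervals can
  tile it later.\<close>

lemma has_bochner_integral_haar_iff:
  fixes f :: "complex \<Rightarrow> complex"
  assumes "f \<in> borel_measurable haar"
  shows "has_bochner_integral haar f x \<longleftrightarrow>
    has_bochner_integral lborel (\<lambda>t. indicator {0..<1::real} t *\<^sub>R f (cis (2 * pi * t))) x"
proof -
  have um: "uniform_measure lborel {0..1::real} = density lborel (indicator {0..<1})"
    unfolding uniform_measure_def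
  proof (rule density_cong)
    have "AE t in lborel. t \<noteq> (1::real)"
      by (rule AE_lborel_singleton)
    then show "AE t in lborel. indicator {0..1::real} t / emeasure lborel {0..1::real} = (indicator {0..<1} t :: ennreal)"
      by eventually_elim (auto simp: indicator_def)
  qed auto
  have f: "f \<in> borel_measurable (restrict_space borel circle)"
    using assms by (simp add: measurable_haar_iff)
  have fc: "(\<lambda>t. f (cis (2 * pi * t))) \<in> borel_measurable lborel"
    using measurable_compose[OF measurable_cis_circle f] by (simp add: measurable_def uniform_measure_def)
  have ind: "density lborel (indicator {0..<1::real}) = density lborel (\<lambda>t. ennreal (indicator {0..<1} t))"
    by (simp add: ennreal_indicator)
  show ?thesis
    unfolding haar_def has_bochner_integral_iff
    using f fc measurable_cis_circle
    by (simp add: integrable_distr_eq integral_distr um ind integrable_density integral_density del: ennreal_indicator)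
qed

text \<open>For \<open>0 < j < N\<close> the ratio is an \<open>N\<close>-th root of unity other
  than 1, so the geometric sum vanishes. This serves both integration over arcs and averaging over
  roots.\<close>

lemma sum_powers_root_of_unity:
  assumes "j < N"
  shows "(\<Sum>k<N. cis (2 * pi * real j / real N) ^ k) = (if j = 0 then of_nat N else 0)"
proof (cases "j = 0")
  case False
  let ?x = "cis (2 * pi * real j / real N)"
  have inj: "inj_on (\<lambda>k. cis (2 * pi * real k / real N)) {..<N}"
    using Complex.bij_betw_roots_unity[of N] assms by (auto simp: bij_betw_def)
  have "?x \<noteq> 1"
    using inj_onD[OF inj, of j 0] assms False by auto
  moreover have "?x ^ N = 1"
    using assms by (simp add: Complex.DeMoivre cis_multiple_2pi)
  ultimately show ?thesis
    using False by (simp add: sum_gp_strict)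
qed auto

text \<open>The intervals \<open>[k / N, (k + 1) / N)\<close> with \<open>k < N\<close> partition
  \<open>[0, 1)\<close>; for \<open>t\<close> in \<open>[0, 1)\<close> the one nonzero term has as
  its index the integer part of \<open>N t\<close>.\<close>

lemma sum_indicator_shifts:
  assumes "N > 0"
  shows "(\<Sum>k<N. indicator {0..<1} (real N * t - real k)) = (indicator {0..<1} t :: real)"
proof (cases "t \<in> {0..<1}")
  case True
  define m where "m = nat \<lfloor>real N * t\<rfloor>"
  have "0 \<le> real N * t" "real N * t < real N"
    using True assms by (auto)
  then have m: "m < N" and m_floor: "real m \<le> real N * t" "real N * t < real m + 1"
    unfolding m_def by linarith+
  have "indicator {0..<1} (real N * t - real k) = (if k = m then 1 else 0 :: real)" for k
    using m_floor by (auto simp: indicator_def)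
  then show ?thesis
    using m True by simp
next
  case False
  have "indicator {0..<1} (real N * t - real k) = (0 :: real)" if "k < N" for k
  proof -
    have "\<not> (0 \<le> real N * t - real k \<and> real N * t - real k < 1)"
    proof
      assume *: "0 \<le> real N * t - real k \<and> real N * t - real k < 1"
      then have "0 \<le> real N * t" "real N * t < real N * 1"
        using that by linarith+
      then have "0 \<le> t" "t < 1"
        using assms by (simp_all add: zero_le_mult_iff)
      then show False
        using False by simp
    qed
    then show ?thesis
      by (simp add: indicator_def)
  qed
  then show ?thesis
    using False by simp
qed

lemma measurable_pow_circle:
  "(\<lambda>z. z ^ N) \<in> restrict_space borel circle \<rightarrow>\<^sub>M restrict_space (borel :: complex measure) circle"
  by (intro measurable_restrict_space2 measurable_restrict_space1)
    (auto simp: space_restrict_space norm_power)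

lemma measurable_haar_pow:
  "F \<in> borel_measurable haar \<Longrightarrow> (\<lambda>z. F (z ^ N)) \<in> borel_measurable haar"
  unfolding measurable_haar_iff by (rule measurable_compose[OF measurable_pow_circle])

lemma borel_measurable_haar_continuous:
  "continuous_on UNIV f \<Longrightarrow> f \<in> borel_measurable haar" for f :: "complex \<Rightarrow> complex"
  unfolding measurable_haar_iff
  by (intro measurable_restrict_space1 borel_measurable_continuous_onI)

text \<open>On the arc \<open>k / N \<le> t < (k + 1) / N\<close> the factor \<open>z ^ j\<close> contributes the \<open>k\<close>-th power of a
  root of unity; summing over the arcs kills all \<open>j\<close> except \<open>j = 0\<close>.\<close>

lemma has_bochner_integral_haar_pow:
  fixes F :: "complex \<Rightarrow> complex"
  assumes "j < N" and F: "integrable haar F"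
  shows "has_bochner_integral haar (\<lambda>z. z ^ j * F (z ^ N)) (if j = 0 then LINT z|haar. F z else 0)"
proof -
  have N: "N > 0"
    using assms by simp
  define G where "G t = indicator {0..<1::real} t *\<^sub>R F (cis (2 * pi * t))" for t
  \<comment> \<open>At \<open>z = cis (2 * pi * t)\<close> the factor \<open>z ^ j\<close> is
    \<open>e (N t)\<close>, which splits as \<open>e k * e (N t - k)\<close> because
    \<open>e\<close> is a character of the real line.\<close>
  define e where "e t = cis (2 * pi * real j / real N * t)" for t
  have Fm: "F \<in> borel_measurable haar"
    using F by auto
  have G: "has_bochner_integral lborel G (LINT z|haar. F z)"
    unfolding G_def
    by (rule has_bochner_integral_haar_iff[OF Fm, THEN iffD1, OF has_bochner_integral_integrable[OF F]])
  have "integrable lborel (\<lambda>t. e t * G t)"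
  proof (rule Bochner_Integration.integrable_bound)
    show "integrable lborel G"
      using G by (rule integrable.intros)
    have "e \<in> borel_measurable lborel"
      unfolding e_def by (auto simp: cis_conv_exp)
    then show "(\<lambda>t. e t * G t) \<in> borel_measurable lborel"
      using G by (intro borel_measurable_times) (auto dest: has_bochner_integral_integrable)
    show "AE t in lborel. norm (e t * G t) \<le> norm (G t)"
      by (simp add: e_def norm_mult)
  qed
  define I where "I = (LINT t|lborel. e t * G t)"
  have H: "has_bochner_integral lborel (\<lambda>t. e t * G t) I"
    unfolding I_def using \<open>integrable lborel (\<lambda>t. e t * G t)\<close> by (rule has_bochner_integral_integrable)
  \<comment> \<open>The substitution \<open>s = N t - k\<close> contributes the factor
    \<open>1 / N\<close>; the integrand is supported on the arc with index \<open>k\<close>.\<close>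
  have piece: "has_bochner_integral lborel
      (\<lambda>t. e (real k) * (e (- real k + real N * t) * G (- real k + real N * t))) (e (real k) * (I /\<^sub>R real N))" for k
    using H lborel_has_bochner_integral_real_affine_iff[of "real N" "\<lambda>t. e t * G t" I "- real k"] N
    by (intro has_bochner_integral_mult_right) auto
  have sums: "has_bochner_integral lborel
      (\<lambda>t. \<Sum>k<N. e (real k) * (e (- real k + real N * t) * G (- real k + real N * t)))
      (\<Sum>k<N. e (real k) * (I /\<^sub>R real N))"
    by (intro has_bochner_integral_sum piece)
  have "(\<Sum>k<N. e (real k) * (e (- real k + real N * t) * G (- real k + real N * t))) =
      indicator {0..<1} t *\<^sub>R (cis (2 * pi * t) ^ j * F (cis (2 * pi * t) ^ N))" for t
  proof -
    have 1: "e (real k) * (e (- real k + real N * t) * G (- real k + real N * t)) =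
        indicator {0..<1} (real N * t - real k) *\<^sub>R (cis (2 * pi * t) ^ j * F (cis (2 * pi * t) ^ N))" for k
    proof -
      have "e (real k) * e (- real k + real N * t) = cis (2 * pi * t) ^ j"
        using N by (simp add: e_def cis_mult Complex.DeMoivre field_simps)
      moreover have "cis (2 * pi * (- real k + real N * t)) = cis (2 * pi * t) ^ N"
      proof -
        have "cis (2 * pi * (- real k + real N * t)) = cis (real N * (2 * pi * t)) / cis (2 * pi * real k)"
          unfolding cis_divide by (simp add: algebra_simps)
        then show ?thesis
          by (simp add: Complex.DeMoivre cis_multiple_2pi)
      qed
      ultimately show ?thesis
        by (simp add: G_def mult.assoc[symmetric] add.commute)
    qed
    show ?thesis
      unfolding 1 scaleR_left.sum[symmetric] sum_indicator_shifts[OF N] ..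
  qed
  \<comment> \<open>The values \<open>e k\<close> sum to 0 unless \<open>j = 0\<close>; in that case
    \<open>e\<close> is constantly 1, \<open>I\<close> is the integral of \<open>F\<close>, and the
    factor \<open>N\<close> cancels.\<close>
  moreover have "(\<Sum>k<N. e (real k) * (I /\<^sub>R real N)) = (if j = 0 then LINT z|haar. F z else 0)"
  proof -
    have "(\<Sum>k<N. e (real k)) = (if j = 0 then of_nat N else 0)"
      unfolding sum_powers_root_of_unity[OF assms(1), symmetric]
      by (simp add: e_def Complex.DeMoivre mult_ac)
    moreover have "I = (LINT z|haar. F z)" if "j = 0"
      using that G by (simp add: I_def e_def has_bochner_integral_iff)
    ultimately show ?thesis
      using N by (simp add: sum_distrib_right[symmetric] scaleR_conv_of_real)
  qed
  ultimately have "has_bochner_integral lborel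
      (\<lambda>t. indicator {0..<1} t *\<^sub>R (cis (2 * pi * t) ^ j * F (cis (2 * pi * t) ^ N)))
      (if j = 0 then LINT z|haar. F z else 0)"
    using sums by simp
  moreover have "(\<lambda>z. z ^ j * F (z ^ N)) \<in> borel_measurable haar"
    by (intro borel_measurable_times measurable_haar_pow Fm borel_measurable_haar_continuous
        continuous_intros)
  ultimately show ?thesis
    by (simp add: has_bochner_integral_haar_iff)
qed

lemma finite_measure_haar: "finite_measure haar"
  by standard (simp add: emeasure_haar_circle)

lemma integral_haar_power: "(LINT z|haar. z ^ k) = (if k = 0 then 1 else 0)"
proof -
  have "integrable haar (\<lambda>z. 1 :: complex)"
    using finite_measure_haar by (simp add: finite_measure.integrable_const)
  moreover have "measure haar circle = 1"
    by (simp add: measure_def emeasure_haar_circle)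
  ultimately show ?thesis
    \<comment> \<open>Taking \<open>N = Suc k\<close> puts the exponent \<open>k\<close> into the
      admissible range \<open>j < N\<close>.\<close>
    using has_bochner_integral_haar_pow[of k "Suc k" "\<lambda>_. 1"]
    by (auto simp: has_bochner_integral_iff)
qed

section \<open>Square-integrable functions and trigonometric polynomials\<close>

lemma L2_cong:
  "(\<And>z. z \<in> circle \<Longrightarrow> f z = g z) \<Longrightarrow> f \<in> L2 \<longleftrightarrow> g \<in> L2"
  unfolding L2_def mem_Collect_eq
  by (intro conj_cong measurable_cong Bochner_Integration.integrable_cong) auto

lemma ip_cong:
  assumes "\<And>z. z \<in> circle \<Longrightarrow> f z = f' z" "\<And>z. z \<in> circle \<Longrightarrow> g z = g' z"
  shows "ip f g = ip f' g'"
  unfolding ip_def using assms by (intro Bochner_Integration.integral_cong) auto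

lemma L2_measurable: "f \<in> L2 \<Longrightarrow> f \<in> borel_measurable haar"
  by (simp add: L2_def)

lemma L2_bounded_mult:
  assumes a: "a \<in> borel_measurable haar" "\<And>z. z \<in> circle \<Longrightarrow> cmod (a z) \<le> C" and f: "f \<in> L2"
  shows "(\<lambda>z. a z * f z) \<in> L2"
  unfolding L2_def mem_Collect_eq
proof
  have fm: "f \<in> borel_measurable haar"
    using f by (rule L2_measurable)
  show m: "(\<lambda>z. a z * f z) \<in> borel_measurable haar"
    by (intro borel_measurable_times a fm)
  show "integrable haar (\<lambda>z. (cmod (a z * f z))\<^sup>2)"
  proof (rule Bochner_Integration.integrable_bound)
    show "integrable haar (\<lambda>z. C\<^sup>2 * (cmod (f z))\<^sup>2)"
      using f by (simp add: L2_def)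
    show "(\<lambda>z. (cmod (a z * f z))\<^sup>2) \<in> borel_measurable haar"
      using m by measurable
    show "AE z in haar. norm ((cmod (a z * f z))\<^sup>2) \<le> norm (C\<^sup>2 * (cmod (f z))\<^sup>2)"
      using a(2) by (intro AE_I2) (auto simp: norm_mult power_mult_distrib intro!: mult_right_mono power_mono)
  qed
qed

lemma L2_scale: "f \<in> L2 \<Longrightarrow> (\<lambda>z. c * f z) \<in> L2"
  by (rule L2_bounded_mult[where C = "cmod c"]) auto

lemma L2_add:
  assumes f: "f \<in> L2" and g: "g \<in> L2"
  shows "(\<lambda>z. f z + g z) \<in> L2"
  unfolding L2_def mem_Collect_eq
proof
  show m: "(\<lambda>z. f z + g z) \<in> borel_measurable haar"
    using f g by (intro borel_measurable_add L2_measurable)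
  show "integrable haar (\<lambda>z. (cmod (f z + g z))\<^sup>2)"
  proof (rule Bochner_Integration.integrable_bound)
    show "integrable haar (\<lambda>z. 2 * (cmod (f z))\<^sup>2 + 2 * (cmod (g z))\<^sup>2)"
      using f g by (simp add: L2_def)
    show "(\<lambda>z. (cmod (f z + g z))\<^sup>2) \<in> borel_measurable haar"
      using m by measurable
    have "(cmod (f z + g z))\<^sup>2 \<le> 2 * (cmod (f z))\<^sup>2 + 2 * (cmod (g z))\<^sup>2" for z
    proof -
      have "(cmod (f z + g z))\<^sup>2 \<le> (cmod (f z) + cmod (g z))\<^sup>2"
        by (intro power_mono norm_triangle_ineq) auto
      also have "\<dots> \<le> 2 * (cmod (f z))\<^sup>2 + 2 * (cmod (g z))\<^sup>2"
        using sum_squares_bound[of "cmod (f z)" "cmod (g z)"] by (simp add: power2_sum)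
      finally show ?thesis .
    qed
    then show "AE z in haar. norm ((cmod (f z + g z))\<^sup>2) \<le> norm (2 * (cmod (f z))\<^sup>2 + 2 * (cmod (g z))\<^sup>2)"
      by (intro AE_I2) auto
  qed
qed

lemma L2_diff: "f \<in> L2 \<Longrightarrow> g \<in> L2 \<Longrightarrow> (\<lambda>z. f z - g z) \<in> L2"
  using L2_add[OF _ L2_scale[of g "-1"]] by simp

lemma L2_const: "(\<lambda>z. c) \<in> L2"
  using finite_measure_haar by (simp add: L2_def finite_measure.integrable_const)

lemma L2_continuous_mult:
  assumes a: "continuous_on UNIV a" and f: "f \<in> L2"
  shows "(\<lambda>z. a z * f z) \<in> L2"
proof -
  have "compact (a ` circle)"
    using a by (intro compact_continuous_image) (auto intro: continuous_on_subset)
  then obtain C where "\<And>z. z \<in> circle \<Longrightarrow> cmod (a z) \<le> C"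
    unfolding compact_eq_bounded_closed bounded_iff by blast
  then show ?thesis
    by (rule L2_bounded_mult[OF borel_measurable_haar_continuous[OF a] _ f])
qed

lemma L2_continuous: "continuous_on UNIV f \<Longrightarrow> f \<in> L2"
  using L2_continuous_mult[OF _ L2_const[of 1]] by simp

text \<open>The map \<open>z ^ N\<close> preserves Haar measure, which is the case
  \<open>j = 0\<close> of the integration formula. It is applied to the squared modulus viewed as a
  complex function; taking norms at the end returns to the reals.\<close>

lemma L2_pow:
  assumes "N > 0" and f: "f \<in> L2"
  shows "(\<lambda>z. f (z ^ N)) \<in> L2"
  unfolding L2_def mem_Collect_eq
proof
  show "(\<lambda>z. f (z ^ N)) \<in> borel_measurable haar"
    using f by (intro measurable_haar_pow L2_measurable)
  have "integrable haar (\<lambda>z. complex_of_real ((cmod (f z))\<^sup>2))"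
    using f by (simp add: L2_def del: of_real_power)
  then have "integrable haar (\<lambda>z. z ^ 0 * complex_of_real ((cmod (f (z ^ N)))\<^sup>2))"
    using has_bochner_integral_haar_pow[of 0 N "\<lambda>z. complex_of_real ((cmod (f z))\<^sup>2)"] \<open>N > 0\<close>
    by (auto simp: has_bochner_integral_iff simp del: of_real_power)
  from integrable_norm[OF this] show "integrable haar (\<lambda>z. (cmod (f (z ^ N)))\<^sup>2)"
    by (simp add: norm_power)
qed

lemma L2_sum: "(\<And>n. n \<in> I \<Longrightarrow> f n \<in> L2) \<Longrightarrow> (\<lambda>z. \<Sum>n\<in>I. f n z) \<in> L2"
  by (induction I rule: infinite_finite_induct) (auto intro: L2_add L2_continuous)

lemma L2_cnj: "f \<in> L2 \<Longrightarrow> (\<lambda>z. cnj (f z)) \<in> L2"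
  unfolding L2_def
  by (auto intro: borel_measurable_continuous_on[where f = cnj] continuous_intros)

lemma cnj_circle: "z \<in> circle \<Longrightarrow> cnj z = inverse z"
  using complex_norm_square[of z] by (auto intro!: inverse_unique[symmetric])

lemma L2_e_fun: "e_fun n \<in> L2"
proof (cases "n \<ge> 0")
  case True
  then show ?thesis
    by (intro L2_continuous) (simp add: e_fun_def power_int_def[abs_def] continuous_intros)
next
  case False
  \<comment> \<open>Negative powers are discontinuous at 0, but on the circle they agree with
    conjugates of polynomials, which are continuous everywhere.\<close>
  have "e_fun n z = cnj (z ^ nat (- n))" if "z \<in> circle" for z
    using that False by (simp add: e_fun_def power_int_def cnj_circle)
  then show ?thesis
    by (subst L2_cong) (auto intro!: L2_continuous continuous_intros)
qed

lemma L2_trig_sum: "(\<lambda>z. \<Sum>n\<in>I. c n * e_fun (s n) z) \<in> L2"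
  by (intro L2_sum L2_scale L2_e_fun)

section \<open>Inner products and orthonormality of the powers of \<open>z\<close>\<close>

lemma L2_prod_integrable:
  assumes f: "f \<in> L2" and g: "g \<in> L2"
  shows "integrable haar (\<lambda>z. f z * g z)"
proof (rule Bochner_Integration.integrable_bound)
  show "integrable haar (\<lambda>z. (cmod (f z))\<^sup>2 + (cmod (g z))\<^sup>2)"
    using f g by (simp add: L2_def)
  show "(\<lambda>z. f z * g z) \<in> borel_measurable haar"
    using f g by (intro borel_measurable_times L2_measurable)
  have "cmod (f z) * cmod (g z) \<le> (cmod (f z))\<^sup>2 + (cmod (g z))\<^sup>2" for z
    using sum_squares_bound[of "cmod (f z)" "cmod (g z)"] mult_nonneg_nonneg[of "cmod (f z)" "cmod (g z)"]
    by (simp del: mult_nonneg_nonneg)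
  then show "AE z in haar. norm (f z * g z) \<le> norm ((cmod (f z))\<^sup>2 + (cmod (g z))\<^sup>2)"
    by (intro AE_I2) (auto simp: norm_mult)
qed

lemma ip_integrable: "f \<in> L2 \<Longrightarrow> g \<in> L2 \<Longrightarrow> integrable haar (\<lambda>z. f z * cnj (g z))"
  by (intro L2_prod_integrable L2_cnj)

lemma ip_commute: "ip g f = cnj (ip f g)"
  unfolding ip_def by (simp flip: Bochner_Integration.integral_cnj add: mult.commute)

lemma ip_scale_left: "ip (\<lambda>z. c * f z) g = c * ip f g"
  by (simp add: ip_def mult.assoc)

lemma ip_scale_right: "ip f (\<lambda>z. c * g z) = cnj c * ip f g"
  by (simp add: ip_commute[of f] ip_scale_left)

lemma ip_diff_left:
  "f \<in> L2 \<Longrightarrow> g \<in> L2 \<Longrightarrow> h \<in> L2 \<Longrightarrow> ip (\<lambda>z. f z - g z) h = ip f h - ip g h"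
  by (simp add: ip_def left_diff_distrib ip_integrable)

lemma ip_diff_right:
  "f \<in> L2 \<Longrightarrow> g \<in> L2 \<Longrightarrow> h \<in> L2 \<Longrightarrow> ip h (\<lambda>z. f z - g z) = ip h f - ip h g"
  by (simp add: ip_commute[of h] ip_diff_left)

lemma ip_sum_left:
  "(\<And>n. n \<in> I \<Longrightarrow> f n \<in> L2) \<Longrightarrow> h \<in> L2 \<Longrightarrow> ip (\<lambda>z. \<Sum>n\<in>I. f n z) h = (\<Sum>n\<in>I. ip (f n) h)"
  by (simp add: ip_def sum_distrib_right ip_integrable)

lemma ip_sum_right:
  "(\<And>n. n \<in> I \<Longrightarrow> f n \<in> L2) \<Longrightarrow> h \<in> L2 \<Longrightarrow> ip h (\<lambda>z. \<Sum>n\<in>I. f n z) = (\<Sum>n\<in>I. ip h (f n))"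
  by (simp add: ip_commute[of h] ip_sum_left)

lemma ip_self_eq_0:
  assumes f: "f \<in> L2" and "ip f f = 0"
  shows "AE z in haar. f z = 0"
proof -
  have int: "integrable haar (\<lambda>z. (cmod (f z))\<^sup>2)"
    using f by (simp add: L2_def)
  have "ip f f = complex_of_real (LINT z|haar. (cmod (f z))\<^sup>2)"
    unfolding ip_def complex_norm_square[symmetric] of_real_power[symmetric]
    by (rule integral_of_real[OF int])
  then have "(LINT z|haar. (cmod (f z))\<^sup>2) = 0"
    using assms(2) by simp
  then have "AE z in haar. (cmod (f z))\<^sup>2 = 0"
    using integral_nonneg_eq_0_iff_AE[OF int] by simp
  then show ?thesis
    by eventually_elim simp
qed

lemma ip_e_fun: "ip (e_fun m) (e_fun n) = (if m = n then 1 else 0)"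
proof -
  \<comment> \<open>Only nonnegative powers have been integrated so far; the case
    \<open>m < n\<close> follows by conjugate symmetry.\<close>
  have nonneg: "ip (e_fun m) (e_fun n) = (if m = n then 1 else 0)" if "n \<le> m" for m n
  proof -
    have "e_fun m z * cnj (e_fun n z) = z ^ nat (m - n)" if z: "z \<in> circle" for z
    proof -
      have z0: "z \<noteq> 0" "cnj z = inverse z"
        using z by (auto simp: cnj_circle)
      have "e_fun m z * cnj (e_fun n z) = z powi m * inverse z powi n"
        by (simp add: e_fun_def z0)
      also have "\<dots> = z powi (m - n)"
        using z0 by (simp add: power_int_diff power_int_inverse field_simps)
      also have "\<dots> = z ^ nat (m - n)"
        using \<open>n \<le> m\<close> by (simp add: power_int_def)
      finally show ?thesis .
    qed
    then have "ip (e_fun m) (e_fun n) = (LINT z|haar. z ^ nat (m - n))"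
      unfolding ip_def by (intro Bochner_Integration.integral_cong) auto
    then show ?thesis
      using that by (auto simp: integral_haar_power)
  qed
  show ?thesis
    using nonneg[of n m] nonneg[of m n] ip_commute[of "e_fun m" "e_fun n"]
    by (cases "n \<le> m") auto
qed

section \<open>Fourier coefficients in spans of finitely many powers, projections and
  adjoints\<close>

lemma ip_trig_sum_e_fun:
  assumes "finite I"
  shows "ip (\<lambda>z. \<Sum>n\<in>I. c n * e_fun n z) (e_fun m) = (if m \<in> I then c m else 0)"
proof -
  have "ip (\<lambda>z. \<Sum>n\<in>I. c n * e_fun n z) (e_fun m) = (\<Sum>n\<in>I. c n * (if n = m then 1 else 0))"
    by (subst ip_sum_left) (auto simp: ip_scale_left ip_e_fun intro: L2_scale L2_e_fun)
  also have "\<dots> = (if m \<in> I then c m else 0)"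
    using assms by (simp add: if_distrib cong: if_cong)
  finally show ?thesis .
qed

lemma span_e_subset_L2: "f \<in> span_e I \<Longrightarrow> f \<in> L2"
  unfolding span_e_def by (auto intro!: L2_trig_sum[of _ "\<lambda>n. n"])

lemma span_e_expansion:
  assumes "finite I" "f \<in> span_e I"
  shows "f = (\<lambda>z. \<Sum>n\<in>I. ip f (e_fun n) * e_fun n z)"
proof -
  obtain c where f: "f = (\<lambda>z. \<Sum>n\<in>I. c n * e_fun n z)"
    using assms by (auto simp: span_e_def)
  show ?thesis
    by (subst f, rule ext, rule sum.cong) (simp_all add: f ip_trig_sum_e_fun assms)
qed

lemma e_fun_in_span_e: "finite I \<Longrightarrow> n \<in> I \<Longrightarrow> e_fun n \<in> span_e I"
  unfolding span_e_def mem_Collect_eq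
  by (rule exI[of _ "\<lambda>k. if k = n then 1 else 0"]) (auto simp: if_distrib[of "\<lambda>x. x * _"] cong: if_cong)

lemma span_e_scale: "f \<in> span_e I \<Longrightarrow> (\<lambda>z. c * f z) \<in> span_e I"
  unfolding span_e_def by (auto simp: sum_distrib_left mult.assoc[symmetric])

lemma span_e_sum:
  assumes "\<And>k. k \<in> J \<Longrightarrow> f k \<in> span_e I"
  shows "(\<lambda>z. \<Sum>k\<in>J. f k z) \<in> span_e I"
proof -
  have "\<forall>k\<in>J. \<exists>c. f k = (\<lambda>z. \<Sum>n\<in>I. c n * e_fun n z)"
    using assms by (auto simp: span_e_def)
  then obtain c where c: "\<And>k. k \<in> J \<Longrightarrow> f k = (\<lambda>z. \<Sum>n\<in>I. c k n * e_fun n z)"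
    by metis
  have "(\<lambda>z. \<Sum>k\<in>J. f k z) = (\<lambda>z. \<Sum>n\<in>I. (\<Sum>k\<in>J. c k n) * e_fun n z)"
    by (rule ext) (simp add: c sum_distrib_right sum.swap[of _ I J])
  then show ?thesis
    unfolding span_e_def by auto
qed

text \<open>Fourier coefficients determine an element of a finite span as a function, not merely
  almost everywhere. Choices made by \<open>SOME\<close> inside such a span are therefore genuinely
  unique.\<close>

lemma span_e_eqI:
  assumes "finite I" "f \<in> span_e I" "g \<in> span_e I" "\<And>n. n \<in> I \<Longrightarrow> ip f (e_fun n) = ip g (e_fun n)"
  shows "f = g"
  using assms by (subst span_e_expansion[OF assms(1,2)], subst span_e_expansion[OF assms(1,3)]) simp

text \<open>The partial Fourier sum has the defining property, so the chosen element has it too;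
  both then share their Fourier coefficients on \<open>I\<close> and coincide.\<close>

lemma proj_on_span_e:
  assumes I: "finite I" and f: "f \<in> L2"
  shows "proj_on (span_e I) f = (\<lambda>z. \<Sum>n\<in>I. ip f (e_fun n) * e_fun n z)" (is "_ = ?p")
proof -
  have p: "?p \<in> span_e I"
    by (auto simp: span_e_def)
  have coeff: "ip ?p (e_fun n) = ip f (e_fun n)" if "n \<in> I" for n
    using that I by (simp add: ip_trig_sum_e_fun)
  have "?p \<in> span_e I \<and> (\<forall>h\<in>span_e I. ip (\<lambda>z. f z - ?p z) h = 0)"
  proof (intro conjI ballI p)
    fix h assume h: "h \<in> span_e I"
    have d: "(\<lambda>z. f z - ?p z) \<in> L2"
      using f span_e_subset_L2[OF p] by (rule L2_diff)
    have "ip (\<lambda>z. f z - ?p z) (\<lambda>z. \<Sum>n\<in>I. ip h (e_fun n) * e_fun n z) = 0"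
      using d coeff f span_e_subset_L2[OF p]
      by (subst ip_sum_right) (auto simp: ip_scale_right ip_diff_left L2_e_fun intro: L2_scale L2_e_fun)
    then show "ip (\<lambda>z. f z - ?p z) h = 0"
      using span_e_expansion[OF I h] by simp
  qed
  then have q: "proj_on (span_e I) f \<in> span_e I \<and> (\<forall>h\<in>span_e I. ip (\<lambda>z. f z - proj_on (span_e I) f z) h = 0)"
    unfolding proj_on_def
    by (rule someI[where P = "\<lambda>g. g \<in> span_e I \<and> (\<forall>h\<in>span_e I. ip (\<lambda>z. f z - g z) h = 0)"])
  show ?thesis
  proof (rule span_e_eqI[OF I _ p])
    show "proj_on (span_e I) f \<in> span_e I"
      using q ..
    fix n assume n: "n \<in> I"
    have "ip f (e_fun n) - ip (proj_on (span_e I) f) (e_fun n) = 0"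
      using q f e_fun_in_span_e[OF I n] span_e_subset_L2[of "proj_on (span_e I) f" I]
      by (simp flip: ip_diff_left add: L2_e_fun)
    then show "ip (proj_on (span_e I) f) (e_fun n) = ip ?p (e_fun n)"
      using coeff[OF n] by simp
  qed
qed

text \<open>Once some \<open>w\<close> satisfies the adjoint identity, testing it on each
  \<open>e_fun n\<close> fixes all coefficients of the chosen element.\<close>

lemma adj_on_span_e:
  assumes I: "finite I" and w: "w \<in> span_e I" "\<And>h. h \<in> span_e I \<Longrightarrow> ip (S h) f = ip h w"
  shows "adj_on (span_e I) S f = w"
proof -
  have "w \<in> span_e I \<and> (\<forall>h\<in>span_e I. ip (S h) f = ip h w)"
    using w by blast
  then have q: "adj_on (span_e I) S f \<in> span_e I \<and> (\<forall>h\<in>span_e I. ip (S h) f = ip h (adj_on (span_e I) S f))"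
    unfolding adj_on_def
    by (rule someI[where P = "\<lambda>g. g \<in> span_e I \<and> (\<forall>h\<in>span_e I. ip (S h) f = ip h g)"])
  show ?thesis
  proof (rule span_e_eqI[OF I _ w(1)])
    fix n assume "n \<in> I"
    then have "ip (e_fun n) (adj_on (span_e I) S f) = ip (e_fun n) w"
      using q w(2) e_fun_in_span_e[OF I] by metis
    then show "ip (adj_on (span_e I) S f) (e_fun n) = ip w (e_fun n)"
      by (metis ip_commute)
  qed (use q in blast)
qed

text \<open>In the whole space uniqueness is only almost everywhere: the difference of two
  candidates is orthogonal to all of \<open>L2\<close>, in particular to itself.\<close>

lemma adj_on_L2:
  assumes w: "w \<in> L2" "\<And>h. h \<in> L2 \<Longrightarrow> ip (S h) f = ip h w"
  shows "L2_eq (adj_on L2 S f) w"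
proof -
  have "w \<in> L2 \<and> (\<forall>h\<in>L2. ip (S h) f = ip h w)"
    using w by blast
  then have q: "adj_on L2 S f \<in> L2 \<and> (\<forall>h\<in>L2. ip (S h) f = ip h (adj_on L2 S f))"
    unfolding adj_on_def
    by (rule someI[where P = "\<lambda>g. g \<in> L2 \<and> (\<forall>h\<in>L2. ip (S h) f = ip h g)"])
  define d where "d z = adj_on L2 S f z - w z" for z
  have d: "d \<in> L2"
    unfolding d_def[abs_def] using q w by (intro L2_diff) auto
  have "ip d d = ip d (adj_on L2 S f) - ip d w"
    using q w d by (subst ip_diff_right[symmetric]) (auto simp: d_def[abs_def])
  also have "\<dots> = 0"
    using q w(2)[OF d] d by auto
  finally have "AE z in haar. d z = 0"
    by (rule ip_self_eq_0[OF d])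
  then show ?thesis
    unfolding L2_eq_def by eventually_elim (simp add: d_def)
qed

lemma ip_cong_AE:
  assumes "L2_eq f g" "f \<in> L2" "g \<in> L2" "h \<in> L2"
  shows "ip f h = ip g h"
  unfolding ip_def
proof (rule integral_cong_AE)
  show "AE z in haar. f z * cnj (h z) = g z * cnj (h z)"
    using assms(1) unfolding L2_eq_def by eventually_elim simp
qed (use assms in \<open>auto dest: ip_integrable\<close>)

section \<open>Unitary matrices and polynomial loops\<close>

lemma mat_adjoint_dim [simp]:
  "dim_row (mat_adjoint A) = dim_col A" "dim_col (mat_adjoint A) = dim_row A"
  by (simp_all add: mat_adjoint_def)

lemma mat_adjoint_index:
  "i < dim_col A \<Longrightarrow> j < dim_row A \<Longrightarrow> mat_adjoint A $$ (i, j) = conjugate (A $$ (j, i))"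
  by (simp add: mat_adjoint_def mat_of_rows_def)

lemma mat_adjoint_carrier: "A \<in> carrier_mat n m \<Longrightarrow> mat_adjoint A \<in> carrier_mat m n"
  by (auto simp: mat_adjoint_def)

lemma mult_mat_index:
  assumes "A \<in> carrier_mat n m" "B \<in> carrier_mat m k" "i < n" "j < k"
  shows "(A * B) $$ (i, j) = (\<Sum>l<m. A $$ (i, l) * B $$ (l, j))"
  using assms by (auto simp: scalar_prod_def atLeast0LessThan intro!: sum.cong)

text \<open>Orthonormality of columns and rows in coordinates is the form in which a row and a
  column can be split off.\<close>

lemma unitary_group_iff:
  "U \<in> unitary_group n \<longleftrightarrow> U \<in> carrier_mat n n \<and>
     (\<forall>i<n. \<forall>j<n. (\<Sum>l<n. cnj (U $$ (l, i)) * U $$ (l, j)) = of_bool (i = j)) \<and>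
     (\<forall>i<n. \<forall>j<n. (\<Sum>l<n. U $$ (i, l) * cnj (U $$ (j, l))) = of_bool (i = j))"
proof (cases "U \<in> carrier_mat n n")
  case True
  note a = mat_adjoint_carrier[OF True]
  have eq1: "M = 1\<^sub>m n \<longleftrightarrow> (\<forall>i<n. \<forall>j<n. M $$ (i, j) = of_bool (i = j))"
    if "M \<in> carrier_mat n n" for M :: "complex mat"
    using that by (auto intro!: eq_matI)
  have 1: "(mat_adjoint U * U) $$ (i, j) = (\<Sum>l<n. cnj (U $$ (l, i)) * U $$ (l, j))"
    if "i < n" "j < n" for i j
    using that True by (subst mult_mat_index[OF a True]) (auto simp: mat_adjoint_index conjugate_complex_def)
  have 2: "(U * mat_adjoint U) $$ (i, j) = (\<Sum>l<n. U $$ (i, l) * cnj (U $$ (j, l)))"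
    if "i < n" "j < n" for i j
    using that True by (subst mult_mat_index[OF True a]) (auto simp: mat_adjoint_index conjugate_complex_def)
  show ?thesis
    using True a by (simp add: unitary_group_def eq1 1 2 del: index_mult_mat(1))
qed (simp add: unitary_group_def)

lemma unitary_carrier: "U \<in> unitary_group n \<Longrightarrow> U \<in> carrier_mat n n"
  by (simp add: unitary_group_def)

lemma mat_adjoint_adjoint: "mat_adjoint (mat_adjoint A) = (A :: complex mat)"
  by (rule eq_matI) (simp_all add: mat_adjoint_index)

lemma unitary_adjoint: "U \<in> unitary_group n \<Longrightarrow> mat_adjoint U \<in> unitary_group n"
  by (simp add: unitary_group_def mat_adjoint_adjoint mat_adjoint_carrier)

lemma mat_adjoint_mult:
  fixes A B :: "complex mat"
  assumes A: "A \<in> carrier_mat n m" and B: "B \<in> carrier_mat m k"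
  shows "mat_adjoint (A * B) = mat_adjoint B * mat_adjoint A"
proof (rule eq_matI)
  fix i j assume "i < dim_row (mat_adjoint B * mat_adjoint A)" "j < dim_col (mat_adjoint B * mat_adjoint A)"
  then have ij: "i < k" "j < n"
    using A B by (simp_all)
  then have "mat_adjoint (A * B) $$ (i, j) = cnj ((A * B) $$ (j, i))"
    using A B by (subst mat_adjoint_index) (simp_all add: conjugate_complex_def)
  also have "\<dots> = (\<Sum>l<m. cnj (B $$ (l, i)) * cnj (A $$ (j, l)))"
    unfolding mult_mat_index[OF A B ij(2,1)] by (simp add: mult.commute)
  also have "\<dots> = (\<Sum>l<m. mat_adjoint B $$ (i, l) * mat_adjoint A $$ (l, j))"
    using A B ij by (intro sum.cong) (simp_all add: mat_adjoint_index conjugate_complex_def)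
  also have "\<dots> = (mat_adjoint B * mat_adjoint A) $$ (i, j)"
    by (rule mult_mat_index[OF mat_adjoint_carrier[OF B] mat_adjoint_carrier[OF A] ij, symmetric])
  finally show "mat_adjoint (A * B) $$ (i, j) = (mat_adjoint B * mat_adjoint A) $$ (i, j)" .
qed (simp_all)

lemma unitary_mult:
  assumes U: "U \<in> unitary_group n" and V: "V \<in> unitary_group n"
  shows "U * V \<in> unitary_group n"
proof -
  note c = unitary_carrier[OF U] unitary_carrier[OF V]
  note a = c[THEN mat_adjoint_carrier]
  have u: "mat_adjoint U * U = 1\<^sub>m n" "U * mat_adjoint U = 1\<^sub>m n"
    and v: "mat_adjoint V * V = 1\<^sub>m n" "V * mat_adjoint V = 1\<^sub>m n"
    using U V by (simp_all add: unitary_group_def)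
  have "mat_adjoint V * mat_adjoint U * (U * V) = mat_adjoint V * (mat_adjoint U * (U * V))"
    by (rule assoc_mult_mat[OF a(2,1) mult_carrier_mat[OF c]])
  also have "mat_adjoint U * (U * V) = mat_adjoint U * U * V"
    by (rule assoc_mult_mat[OF a(1) c, symmetric])
  also have "mat_adjoint V * (mat_adjoint U * U * V) = 1\<^sub>m n"
    by (simp only: u left_mult_one_mat[OF c(2)] v)
  finally have 1: "mat_adjoint V * mat_adjoint U * (U * V) = 1\<^sub>m n" .
  have "U * V * (mat_adjoint V * mat_adjoint U) = U * (V * (mat_adjoint V * mat_adjoint U))"
    by (rule assoc_mult_mat[OF c mult_carrier_mat[OF a(2,1)]])
  also have "V * (mat_adjoint V * mat_adjoint U) = V * mat_adjoint V * mat_adjoint U"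
    by (rule assoc_mult_mat[OF c(2) a(2,1), symmetric])
  also have "U * (V * mat_adjoint V * mat_adjoint U) = 1\<^sub>m n"
    by (simp only: v left_mult_one_mat[OF a(1)] u)
  finally have 2: "U * V * (mat_adjoint V * mat_adjoint U) = 1\<^sub>m n" .
  show ?thesis
    unfolding unitary_group_def mem_Collect_eq mat_adjoint_mult[OF c]
    by (intro conjI mult_carrier_mat[OF c] 1 2)
qed

text \<open>The adjoint exhibits \<open>U\<close> as a unit of the matrix ring, which excludes the
  result \<open>None\<close>; uniqueness of inverses then identifies the result.\<close>

lemma unitary_mat_inverse:
  assumes "U \<in> unitary_group n"
  shows "the (mat_inverse U) = mat_adjoint U"
proof -
  note c = unitary_carrier[OF assms]
  note a = mat_adjoint_carrier[OF c]
  have u: "mat_adjoint U * U = 1\<^sub>m n" "U * mat_adjoint U = 1\<^sub>m n"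
    using assms by (simp_all add: unitary_group_def)
  have "U \<in> Units (ring_mat TYPE(complex) n ())"
    unfolding Units_def ring_mat_simps using a c u by blast
  then obtain B where B: "mat_inverse U = Some B"
    using mat_inverse(1)[OF c, where b = "()"] by (cases "mat_inverse U") auto
  then have B': "B * U = 1\<^sub>m n" "B \<in> carrier_mat n n"
    using mat_inverse(2)[OF c B] by auto
  have "B = B * (U * mat_adjoint U)"
    using u(2) B' by (simp only: right_mult_one_mat)
  also have "\<dots> = B * U * mat_adjoint U"
    by (rule assoc_mult_mat[OF B'(2) c a, symmetric])
  also have "\<dots> = mat_adjoint U"
    unfolding B'(1) by (rule left_mult_one_mat[OF a])
  finally show ?thesis
    by (simp add: B)
qed

text \<open>Since column 0 is the first unit vector, its inner product with column \<open>j\<close>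
  is the entry of row 0, and orthonormality of the columns evaluates it.\<close>

lemma unitary_first_row:
  assumes U: "U \<in> unitary_group n" and "j < n" and col: "\<And>i. i < n \<Longrightarrow> U $$ (i, 0) = of_bool (i = 0)"
  shows "U $$ (0, j) = of_bool (j = 0)"
proof -
  have "(\<Sum>l<n. cnj (U $$ (l, 0)) * U $$ (l, j)) = of_bool (0 = j)"
    using U assms(2) unfolding unitary_group_iff by auto
  moreover have "(\<Sum>l<n. cnj (U $$ (l, 0)) * U $$ (l, j)) = (\<Sum>l<n. if l = 0 then U $$ (l, j) else 0)"
    by (intro sum.cong) (auto simp: col)
  ultimately show ?thesis
    using assms(2) by auto
qed

text \<open>Row 0 and column 0 contribute only zero terms to the inner products of the remaining
  columns and rows, so orthonormality passes to the minor.\<close>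

lemma unitary_minor:
  assumes U: "U \<in> unitary_group (Suc n)"
    and col: "\<And>i. i < Suc n \<Longrightarrow> U $$ (i, 0) = of_bool (i = 0)"
  shows "mat n n (\<lambda>(i, j). U $$ (Suc i, Suc j)) \<in> unitary_group n"
proof -
  have row: "U $$ (0, j) = of_bool (j = 0)" if "j < Suc n" for j
    using unitary_first_row[OF U that col] .
  have "(\<Sum>l<Suc n. cnj (U $$ (l, Suc i)) * U $$ (l, Suc j)) = of_bool (i = j)"
    "(\<Sum>l<Suc n. U $$ (Suc i, l) * cnj (U $$ (Suc j, l))) = of_bool (i = j)"
    if "i < n" "j < n" for i j
    using U that unfolding unitary_group_iff by auto
  then show ?thesis
    unfolding unitary_group_iff by (simp add: sum.lessThan_Suc_shift row col del: sum.lessThan_Suc)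
qed

lemma four_block_one:
  assumes U: "U \<in> unitary_group (Suc n)"
    and col: "\<And>i. i < Suc n \<Longrightarrow> U $$ (i, 0) = of_bool (i = 0)"
  shows "U = four_block_mat (1\<^sub>m 1) (0\<^sub>m 1 n) (0\<^sub>m n 1) (mat n n (\<lambda>(i, j). U $$ (Suc i, Suc j)))"
proof (rule eq_matI)
  fix i j
  assume "i < dim_row (four_block_mat (1\<^sub>m 1) (0\<^sub>m 1 n) (0\<^sub>m n 1) (mat n n (\<lambda>(i, j). U $$ (Suc i, Suc j))))"
    "j < dim_col (four_block_mat (1\<^sub>m 1) (0\<^sub>m 1 n) (0\<^sub>m n 1) (mat n n (\<lambda>(i, j). U $$ (Suc i, Suc j))))"
  then have "i < Suc n" "j < Suc n"
    by auto
  then show "U $$ (i, j) = four_block_mat (1\<^sub>m 1) (0\<^sub>m 1 n) (0\<^sub>m n 1) (mat n n (\<lambda>(i, j). U $$ (Suc i, Suc j))) $$ (i, j)"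
    using unitary_first_row[OF U _ col, of j] col[of i] by (cases i; cases j) auto
qed (use unitary_carrier[OF U] in auto)

section \<open>Polynomial loops with constant first column\<close>

lemma poly_loop_entry:
  assumes "A \<in> poly_loops n" "i < n" "j < n"
  obtains p where "\<And>z. z \<in> circle \<Longrightarrow> A z $$ (i, j) = poly p z"
  using assms unfolding poly_loops_def by blast

lemma poly_loop_unitary: "A \<in> poly_loops n \<Longrightarrow> z \<in> circle \<Longrightarrow> A z \<in> unitary_group n"
  by (simp add: poly_loops_def)

text \<open>This supplies the loop \<open>B\<close> of (ii) and of (iii), in both cases with
  \<open>U\<close> the adjoint of \<open>A 1\<close>. Entries stay polynomial because
  \<open>U\<close> does not depend on \<open>z\<close>.\<close>

lemma poly_loop_minor:
  assumes A: "A \<in> poly_loops (Suc n)" and U: "U \<in> unitary_group (Suc n)"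
    and col: "\<And>z i. z \<in> circle \<Longrightarrow> i < Suc n \<Longrightarrow> (U * A z) $$ (i, 0) = of_bool (i = 0)"
  shows "(\<lambda>z. mat n n (\<lambda>(i, j). (U * A z) $$ (Suc i, Suc j))) \<in> poly_loops n"
  unfolding poly_loops_def mem_Collect_eq
proof (intro conjI ballI allI impI)
  fix z :: complex assume "z \<in> circle"
  then show "mat n n (\<lambda>(i, j). (U * A z) $$ (Suc i, Suc j)) \<in> unitary_group n"
    by (intro unitary_minor unitary_mult U poly_loop_unitary[OF A] col)
next
  fix i j assume ij: "i < n" "j < n"
  obtain p where p: "\<And>l z. l < Suc n \<Longrightarrow> z \<in> circle \<Longrightarrow> A z $$ (l, Suc j) = poly (p l) z"
  proof -
    have "\<forall>l<Suc n. \<exists>q. \<forall>z\<in>circle. A z $$ (l, Suc j) = poly q z"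
      using A ij unfolding poly_loops_def by auto
    then show thesis
      using that by metis
  qed
  have "(U * A z) $$ (Suc i, Suc j) = poly (\<Sum>l<Suc n. Polynomial.smult (U $$ (Suc i, l)) (p l)) z" if "z \<in> circle" for z
    using ij that by (subst mult_mat_index[OF unitary_carrier[OF U] unitary_carrier[OF poly_loop_unitary[OF A]]])
      (auto simp: p poly_sum simp del: sum.lessThan_Suc)
  then show "\<exists>p. \<forall>z\<in>circle. mat n n (\<lambda>(i, j). (U * A z) $$ (Suc i, Suc j)) $$ (i, j) = poly p z"
    using ij by (auto simp del: sum.lessThan_Suc)
qed

text \<open>Column 0 of a product depends on its right factor only through column 0, so
  \<open>V\<close> may be replaced by \<open>U\<close>.\<close>

lemma unitary_mult_fixed_column:
  assumes U: "U \<in> unitary_group n" and V: "V \<in> unitary_group n" and "i < n"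
    and eq: "\<And>i. i < n \<Longrightarrow> V $$ (i, 0) = U $$ (i, 0)"
  shows "(mat_adjoint U * V) $$ (i, 0) = of_bool (i = 0)"
proof -
  note c = unitary_carrier[OF U] unitary_carrier[OF V]
  have "(mat_adjoint U * V) $$ (i, 0) = (mat_adjoint U * U) $$ (i, 0)"
    using \<open>i < n\<close> c mat_adjoint_carrier[OF c(1)] by (simp add: mult_mat_index eq del: index_mult_mat(1))
  also have "\<dots> = of_bool (i = 0)"
    using U \<open>i < n\<close> by (simp add: unitary_group_def)
  finally show ?thesis .
qed

text \<open>Undoing \<open>U\<close> by its adjoint expresses column 0 of \<open>V\<close> as the
  adjoint applied to the first unit vector.\<close>

lemma unitary_recover_column:
  assumes U: "U \<in> unitary_group n" and V: "V \<in> carrier_mat n n" and "i < n"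
    and eq: "\<And>i. i < n \<Longrightarrow> (U * V) $$ (i, 0) = of_bool (i = 0)"
  shows "V $$ (i, 0) = mat_adjoint U $$ (i, 0)"
proof -
  note c = unitary_carrier[OF U]
  have "mat_adjoint U * (U * V) = mat_adjoint U * U * V"
    by (rule assoc_mult_mat[OF mat_adjoint_carrier[OF c] c V, symmetric])
  also have "mat_adjoint U * U = 1\<^sub>m n"
    using U by (simp add: unitary_group_def)
  finally have "V $$ (i, 0) = (mat_adjoint U * (U * V)) $$ (i, 0)"
    by (simp only: left_mult_one_mat[OF V])
  also have "\<dots> = (\<Sum>l<n. mat_adjoint U $$ (i, l) * (U * V) $$ (l, 0))"
    using \<open>i < n\<close> by (intro mult_mat_index[OF mat_adjoint_carrier[OF c] mult_carrier_mat[OF c V]]) auto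
  also have "\<dots> = (\<Sum>l<n. if l = 0 then mat_adjoint U $$ (i, l) else 0)"
    by (intro sum.cong) (auto simp: eq)
  also have "\<dots> = mat_adjoint U $$ (i, 0)"
    using \<open>i < n\<close> by auto
  finally show ?thesis .
qed

text \<open>Multiplying by the inverse of \<open>A 1\<close> turns a column 0 shared with
  \<open>A 1\<close> into the first unit vector; unitarity then clears row 0 as well, leaving a
  block \<open>B z\<close>.\<close>

lemma splits_iff_first_column_const:
  assumes N: "N \<ge> 1" and A: "A \<in> poly_loops N"
  shows "(\<exists>B \<in> poly_loops (N - 1). \<forall>z \<in> circle. the (mat_inverse (A 1)) * A z =
      four_block_mat (1\<^sub>m 1) (0\<^sub>m 1 (N - 1)) (0\<^sub>m (N - 1) 1) (B z)) \<longleftrightarrow>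
    (\<forall>z \<in> circle. \<forall>i<N. A z $$ (i, 0) = A 1 $$ (i, 0))" (is "?L \<longleftrightarrow> ?R")
proof -
  obtain n where n: "N = Suc n"
    using N by (cases N) auto
  have U: "A 1 \<in> unitary_group N"
    by (rule poly_loop_unitary[OF A]) simp
  have adj: "mat_adjoint (A 1) \<in> unitary_group N"
    by (rule unitary_adjoint[OF U])
  have inv: "the (mat_inverse (A 1)) = mat_adjoint (A 1)"
    by (rule unitary_mat_inverse[OF U])
  show ?thesis
  proof
    assume ?L
    then obtain B where B: "B \<in> poly_loops n" and eq: "\<And>z. z \<in> circle \<Longrightarrow>
        mat_adjoint (A 1) * A z = four_block_mat (1\<^sub>m 1) (0\<^sub>m 1 n) (0\<^sub>m n 1) (B z)"
      by (auto simp: n inv)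
    \<comment> \<open>The right side is free of \<open>z\<close>, so comparing the instances at
      \<open>z\<close> and at 1 gives constancy.\<close>
    have "A z $$ (i, 0) = mat_adjoint (mat_adjoint (A 1)) $$ (i, 0)" if z: "z \<in> circle" and "i < N" for z i
    proof (rule unitary_recover_column[OF adj unitary_carrier[OF poly_loop_unitary[OF A z]] \<open>i < N\<close>])
      fix k assume "k < N"
      then show "(mat_adjoint (A 1) * A z) $$ (k, 0) = of_bool (k = 0)"
        unfolding eq[OF z] using unitary_carrier[OF poly_loop_unitary[OF B z]] n by auto
    qed
    then show ?R
      by simp
  next
    assume R: ?R
    have col: "(mat_adjoint (A 1) * A z) $$ (i, 0) = of_bool (i = 0)" if "z \<in> circle" "i < Suc n" for z i
      using R n that(1)
      by (intro unitary_mult_fixed_column[OF U poly_loop_unitary[OF A that(1)]]) (use that in blast)+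
    define B where "B z = mat n n (\<lambda>(i, j). (mat_adjoint (A 1) * A z) $$ (Suc i, Suc j))" for z
    have B: "B \<in> poly_loops (N - 1)"
      unfolding B_def[abs_def] using poly_loop_minor[OF A[unfolded n] adj[unfolded n] col]
      by (simp only: n diff_Suc_1)
    have "the (mat_inverse (A 1)) * A z =
        four_block_mat (1\<^sub>m 1) (0\<^sub>m 1 (N - 1)) (0\<^sub>m (N - 1) 1) (B z)" if z: "z \<in> circle" for z
      unfolding inv B_def n diff_Suc_1
      using four_block_one[OF unitary_mult[OF adj poly_loop_unitary[OF A z], unfolded n] col[OF z]] .
    then show ?L
      by (intro bexI[OF _ B] ballI)
  qed
qed

text \<open>Interchanging the two finite sums shows that mixing the filters by \<open>W\<close> acts
  on the loop as left multiplication by \<open>W\<close>.\<close>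

lemma modified_filter:
  assumes W: "W \<in> carrier_mat N N" and A: "A (z ^ N) \<in> carrier_mat N N" and "i < N"
  shows "(\<Sum>j<N. W $$ (i, j) * wavelet_filter N A j z) = (\<Sum>l<N. z ^ l * (W * A (z ^ N)) $$ (i, l))"
proof -
  have "(\<Sum>l<N. z ^ l * (W * A (z ^ N)) $$ (i, l)) = (\<Sum>l<N. \<Sum>j<N. z ^ l * (W $$ (i, j) * A (z ^ N) $$ (j, l)))"
    using \<open>i < N\<close> by (intro sum.cong) (auto simp: mult_mat_index[OF W A] sum_distrib_left simp del: index_mult_mat(1))
  then show ?thesis
    by (subst (asm) sum.swap) (simp add: wavelet_filter_def sum_distrib_left mult_ac)
qed

text \<open>Averaging over the \<open>N\<close>-th roots of \<open>w\<close> isolates the polyphase component of index \<open>0\<close>.\<close>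

lemma polyphase_zero_component:
  fixes a b :: "nat \<Rightarrow> complex \<Rightarrow> complex"
  assumes N: "N > 0" and w: "w \<in> circle"
    and eq: "\<And>z. z \<in> circle \<Longrightarrow> (\<Sum>l<N. z ^ l * a l (z ^ N)) = (\<Sum>l<N. z ^ l * b l (z ^ N))"
  shows "a 0 w = b 0 w"
proof -
  obtain y where y: "y \<in> circle" "y ^ N = w"
    using circle_nth_root[OF N w] .
  define x where "x k = y * cis (2 * pi * real k / real N)" for k
  have x: "x k \<in> circle" "x k ^ N = w" for k
    using y N by (auto simp: x_def norm_mult power_mult_distrib Complex.DeMoivre cis_multiple_2pi)
  have avg: "(\<Sum>k<N. \<Sum>l<N. x k ^ l * c l (x k ^ N)) = of_nat N * c 0 w" for c :: "nat \<Rightarrow> complex \<Rightarrow> complex"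
  proof -
    have "(\<Sum>k<N. x k ^ l * c l (x k ^ N)) = (if l = 0 then of_nat N * c 0 w else 0)" if "l < N" for l
    proof -
      have "x k ^ l = y ^ l * cis (2 * pi * real l / real N) ^ k" for k
        by (simp add: x_def power_mult_distrib Complex.DeMoivre mult_ac)
      then have "(\<Sum>k<N. x k ^ l * c l (x k ^ N)) = y ^ l * c l w * (\<Sum>k<N. cis (2 * pi * real l / real N) ^ k)"
        by (simp add: x sum_distrib_left mult_ac)
      then show ?thesis
        by (simp add: sum_powers_root_of_unity[OF that])
    qed
    then show ?thesis
      using N by (subst sum.swap) simp
  qed
  have "of_nat N * a 0 w = of_nat N * b 0 w"
    unfolding avg[symmetric] by (intro sum.cong refl eq x)
  then show ?thesis
    using N by simp
qed

text \<open>In polyphase terms (iii) prescribes the entries of \<open>W * A w\<close>. Its component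
  of index 0 is the first column, which must be the first unit vector.\<close>

lemma filter_form_iff_first_column_const:
  assumes N: "N \<ge> 1" and A: "A \<in> poly_loops N"
  shows "(\<exists>W \<in> unitary_group N. \<exists>B \<in> poly_loops (N - 1).
      let m = (\<lambda>i z. \<Sum>j<N. W $$ (i, j) * wavelet_filter N A j z) in
        (\<forall>z \<in> circle. m 0 z = 1) \<and>
        (\<forall>i \<in> {1..N - 1}. \<forall>z \<in> circle.
           m i z = (\<Sum>j = 1..N - 1. B (z ^ N) $$ (i - 1, j - 1) * z ^ j))) \<longleftrightarrow>
    (\<forall>z \<in> circle. \<forall>i<N. A z $$ (i, 0) = A 1 $$ (i, 0))" (is "?L \<longleftrightarrow> ?R")
proof -
  obtain n where n: "N = Suc n"
    using N by (cases N) auto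
  have pow: "z ^ N \<in> circle" if "z \<in> circle" for z :: complex
    using that by (simp add: norm_power)
  have carr: "A z \<in> carrier_mat N N" if "z \<in> circle" for z
    by (rule unitary_carrier[OF poly_loop_unitary[OF A that]])
  have shift: "(\<Sum>j = 1..N - 1. f j) = (\<Sum>j<n. f (Suc j))" for f :: "nat \<Rightarrow> complex"
    by (simp add: n sum.atLeast1_atMost_eq)
  show ?thesis
  proof
    assume ?L
    then obtain W B where W: "W \<in> unitary_group N"
      and m0: "\<And>z. z \<in> circle \<Longrightarrow> (\<Sum>j<N. W $$ (0, j) * wavelet_filter N A j z) = 1"
      and m: "\<And>i z. i \<in> {1..N - 1} \<Longrightarrow> z \<in> circle \<Longrightarrow> (\<Sum>j<N. W $$ (i, j) * wavelet_filter N A j z) =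
        (\<Sum>j = 1..N - 1. B (z ^ N) $$ (i - 1, j - 1) * z ^ j)"
      by (auto simp: Let_def)
    note Wc = unitary_carrier[OF W]
    have "(W * A w) $$ (i, 0) = of_bool (i = 0)" if w: "w \<in> circle" and i: "i < N" for w i
    proof -
      \<comment> \<open>\<open>b\<close> lists the polyphase components of the prescribed filter:
        the constant 1 for \<open>i = 0\<close>, and otherwise no component of index 0. The block
        \<open>B\<close> is indexed from 0, hence the shifts by one.\<close>
      define b where "b l w = (if i = 0 then of_bool (l = 0) else if l = 0 then 0 else B w $$ (i - 1, l - 1))"
        for l w
      have "(W * A w) $$ (i, 0) = b 0 w"
      proof (rule polyphase_zero_component[where a = "\<lambda>l w. (W * A w) $$ (i, l)" and b = b, OF _ w])
        fix z :: complex assume z: "z \<in> circle"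
        have "(\<Sum>l<N. z ^ l * (W * A (z ^ N)) $$ (i, l)) = (\<Sum>j<N. W $$ (i, j) * wavelet_filter N A j z)"
          by (rule modified_filter[where A = A and z = z, OF Wc carr[OF pow[OF z]] i, symmetric])
        also have "\<dots> = (\<Sum>l<N. z ^ l * b l (z ^ N))"
        proof (cases "i = 0")
          case True
          have "(\<Sum>l<N. z ^ l * b l (z ^ N)) = (\<Sum>l<N. if l = 0 then 1 else 0)"
            by (intro sum.cong) (auto simp: b_def True)
          then show ?thesis
            using m0[OF z] N by (simp add: True)
        next
          case False
          have "(\<Sum>l<N. z ^ l * b l (z ^ N)) = (\<Sum>l<n. B (z ^ N) $$ (i - 1, l) * z ^ Suc l)"
            by (simp add: n sum.lessThan_Suc_shift b_def False mult.commute del: sum.lessThan_Suc)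
          moreover have "i \<in> {1..N - 1}"
            using False i by auto
          ultimately show ?thesis
            by (simp only: m[OF _ z] shift diff_Suc_1)
        qed
        finally show "(\<Sum>l<N. z ^ l * (W * A (z ^ N)) $$ (i, l)) = (\<Sum>l<N. z ^ l * b l (z ^ N))" .
      qed (use N in simp)
      then show ?thesis
        by (simp add: b_def)
    qed
    \<comment> \<open>Again only the independence of the right side from \<open>z\<close>
      matters.\<close>
    then have "A z $$ (i, 0) = mat_adjoint W $$ (i, 0)" if "z \<in> circle" "i < N" for z i
      by (rule unitary_recover_column[OF W carr[OF that(1)] that(2) _]) (rule that(1))
    then show ?R
      by simp
  next
    assume R: ?R
    have U: "A 1 \<in> unitary_group N"
      by (rule poly_loop_unitary[OF A]) simp
    define W where "W = mat_adjoint (A 1)"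
    have W: "W \<in> unitary_group N"
      unfolding W_def by (rule unitary_adjoint[OF U])
    note Wc = unitary_carrier[OF W]
    have col: "(W * A z) $$ (i, 0) = of_bool (i = 0)" if "z \<in> circle" "i < Suc n" for z i
      unfolding W_def using R n that(1)
      by (intro unitary_mult_fixed_column[OF U poly_loop_unitary[OF A that(1)]]) (use that in blast)+
    \<comment> \<open>Unitarity trivializes row 0 too, so the modified filter of index 0 reduces to
      its constant term.\<close>
    have row: "(W * A z) $$ (0, j) = of_bool (j = 0)" if "z \<in> circle" "j < N" for z j
      using col[OF that(1)] unfolding n[symmetric]
      by (rule unitary_first_row[OF unitary_mult[OF W poly_loop_unitary[OF A that(1)]] that(2)])
    define B where "B z = mat n n (\<lambda>(i, j). (W * A z) $$ (Suc i, Suc j))" for z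
    have B: "B \<in> poly_loops (N - 1)"
      unfolding B_def[abs_def] using poly_loop_minor[OF A[unfolded n] W[unfolded n] col]
      by (simp only: n diff_Suc_1)
    have m: "(\<Sum>j<N. W $$ (i, j) * wavelet_filter N A j z) =
        (W * A (z ^ N)) $$ (i, 0) + (\<Sum>l<n. z ^ Suc l * (W * A (z ^ N)) $$ (i, Suc l))"
      if "z \<in> circle" "i < N" for z i
      unfolding modified_filter[where A = A and z = z, OF Wc carr[OF pow[OF that(1)]] that(2)]
      by (simp only: n sum.lessThan_Suc_shift power_0 mult_1)
    have m0: "(\<Sum>j<N. W $$ (0, j) * wavelet_filter N A j z) = 1" if z: "z \<in> circle" for z
    proof -
      have "(W * A (z ^ N)) $$ (0, Suc l) = 0" if "l < n" for l
        using row[OF pow[OF z], of "Suc l"] that n by (simp del: index_mult_mat(1))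
      then show ?thesis
        using m[OF z, of 0] col[OF pow[OF z], of 0] N
        by (simp del: index_mult_mat(1))
    qed
    have mi: "(\<Sum>j<N. W $$ (i, j) * wavelet_filter N A j z) =
        (\<Sum>j = 1..N - 1. B (z ^ N) $$ (i - 1, j - 1) * z ^ j)"
      if i: "i \<in> {1..N - 1}" and z: "z \<in> circle" for i z
    proof -
      have "i < N" "i < Suc n" "i \<noteq> 0" "i - 1 < n"
        using i n by auto
      then show ?thesis
        unfolding m[OF z \<open>i < N\<close>] shift col[OF pow[OF z] \<open>i < Suc n\<close>]
        by (auto simp: B_def mult.commute simp del: index_mult_mat(1) intro!: sum.cong)
    qed
    show ?L
      unfolding Let_def by (intro bexI[OF _ W] bexI[OF _ B] conjI ballI m0 mi)
  qed
qed

section \<open>The adjoints of the wavelet operators at the constant function\<close>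

lemma entry_mult_L2:
  assumes A: "A \<in> poly_loops N" "i < N" "j < N" and h: "h \<in> L2"
  shows "(\<lambda>z. A z $$ (i, j) * h z) \<in> L2"
proof -
  obtain p where "\<And>z. z \<in> circle \<Longrightarrow> A z $$ (i, j) = poly p z"
    using poly_loop_entry[OF A] by blast
  then have "(\<lambda>z. A z $$ (i, j) * h z) \<in> L2 \<longleftrightarrow> (\<lambda>z. poly p z * h z) \<in> L2"
    by (intro L2_cong) simp
  then show ?thesis
    using h by (simp add: L2_continuous_mult continuous_intros)
qed

lemma T_op_polyphase:
  "T_op N A i h = (\<lambda>z. \<Sum>j<N. z ^ j * (A (z ^ N) $$ (i, j) * h (z ^ N)))"
  by (simp add: T_op_def wavelet_filter_def sum_distrib_right mult.assoc)

lemma T_op_L2: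
  assumes A: "A \<in> poly_loops N" "i < N" and h: "h \<in> L2"
  shows "T_op N A i h \<in> L2"
proof -
  have "(\<lambda>z. z ^ j * (A (z ^ N) $$ (i, j) * h (z ^ N))) \<in> L2" if "j < N" for j
    using \<open>i < N\<close> by (intro L2_continuous_mult continuous_intros L2_pow[OF _ entry_mult_L2[OF A that h]]) auto
  then show ?thesis
    unfolding T_op_polyphase by (intro L2_sum) auto
qed

text \<open>As \<open>e_fun 0\<close> is constantly 1, the left side integrates the polyphase
  expansion, where only \<open>j = 0\<close> survives; the factor \<open>A z $$ (i, 0)\<close> then
  moves to the second argument as a conjugate.\<close>

lemma ip_T_op_one:
  assumes A: "A \<in> poly_loops N" "i < N" and h: "h \<in> L2"
  shows "ip (T_op N A i h) (e_fun 0) = ip h (\<lambda>z. cnj (A z $$ (i, 0)))"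
proof -
  have int: "integrable haar (\<lambda>z. A z $$ (i, j) * h z)" if "j < N" for j
    using L2_prod_integrable[OF entry_mult_L2[OF A that h] L2_const[of 1]] by simp
  have pieces: "has_bochner_integral haar (\<lambda>z. z ^ j * (A (z ^ N) $$ (i, j) * h (z ^ N)))
      (if j = 0 then LINT z|haar. A z $$ (i, j) * h z else 0)" if "j < N" for j
    by (rule has_bochner_integral_haar_pow[OF that int[OF that]])
  have "has_bochner_integral haar (T_op N A i h)
      (\<Sum>j<N. if j = 0 then LINT z|haar. A z $$ (i, j) * h z else 0)"
    unfolding T_op_polyphase by (intro has_bochner_integral_sum pieces) simp
  then have "(LINT z|haar. T_op N A i h z) = (LINT z|haar. A z $$ (i, 0) * h z)"
    using \<open>i < N\<close> by (simp add: has_bochner_integral_iff)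
  then show ?thesis
    by (simp add: ip_def e_fun_def mult.commute)
qed

section \<open>Fourier coefficients of the first column and the conditions (i) and (iv)\<close>

locale polynomial_loop =
  fixes N g :: nat and A :: "complex \<Rightarrow> complex mat" and Ac :: "nat \<Rightarrow> complex mat"
  assumes N: "N \<ge> 1" and g: "g \<ge> 1" and loop: "A \<in> poly_loops N"
    and coeff_carrier: "\<And>k. k < g \<Longrightarrow> Ac k \<in> carrier_mat N N"
    and A_eq: "\<And>z. z \<in> circle \<Longrightarrow> A z = mat N N (\<lambda>(i, j). \<Sum>k<g. z ^ k * Ac k $$ (i, j))"
begin

text \<open>\<open>u i\<close> is \<open>T\<^sub>i\<^sup>* e\<^sub>0\<close>.\<close>

definition u :: "nat \<Rightarrow> complex \<Rightarrow> complex" where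
  "u i z = (\<Sum>k<g. cnj (Ac k $$ (i, 0)) * e_fun (- int k) z)"

text \<open>The common condition to which all five are reduced. It is phrased by coefficients
  because (i), (iv) and (v) see these directly; \<open>first_column_const_iff\<close> translates it
  into values on the circle.\<close>

definition first_column_const :: bool where
  "first_column_const \<longleftrightarrow> (\<forall>i<N. \<forall>k\<in>{1..<g}. Ac k $$ (i, 0) = 0)"

lemma A_entry: "z \<in> circle \<Longrightarrow> i < N \<Longrightarrow> A z $$ (i, 0) = (\<Sum>k<g. z ^ k * Ac k $$ (i, 0))"
  using N by (simp add: A_eq)

lemma u_eq:
  assumes "z \<in> circle" "i < N"
  shows "u i z = cnj (A z $$ (i, 0))"
proof -
  have "cnj (z ^ k) = e_fun (- int k) z" for k
    using assms by (simp add: e_fun_def cnj_circle power_int_minus power_inverse)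
  then show ?thesis
    using assms by (simp add: u_def A_entry mult.commute del: complex_cnj_power)
qed

lemma u_L2: "u i \<in> L2"
  unfolding u_def[abs_def] by (rule L2_trig_sum)

lemma ip_e_fun_u: "ip (e_fun n) (u i) = (if n \<in> {- int g<..0} then Ac (nat (- n)) $$ (i, 0) else 0)"
proof -
  have "ip (e_fun n) (u i) = (\<Sum>k<g. Ac k $$ (i, 0) * (if n = - int k then 1 else 0))"
    unfolding u_def[abs_def]
    by (subst ip_sum_right) (auto simp: ip_scale_right ip_e_fun intro: L2_scale L2_e_fun)
  \<comment> \<open>A positive \<open>n\<close> matches no \<open>k\<close>, which the conversion by
    \<open>nat\<close> alone would not exclude.\<close>
  also have "\<dots> = (\<Sum>k<g. if k = nat (- n) \<and> n \<le> 0 then Ac k $$ (i, 0) else 0)"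
    by (intro sum.cong) auto
  also have "\<dots> = (if n \<in> {- int g<..0} then Ac (nat (- n)) $$ (i, 0) else 0)"
    by (cases "n \<le> 0") auto
  finally show ?thesis .
qed

lemma u_const: "first_column_const \<Longrightarrow> i < N \<Longrightarrow> u i = (\<lambda>z. cnj (Ac 0 $$ (i, 0)) * e_fun 0 z)"
proof -
  assume *: "first_column_const" "i < N"
  have "(\<Sum>k<g. cnj (Ac k $$ (i, 0)) * e_fun (- int k) z) = (\<Sum>k\<in>{0}. cnj (Ac k $$ (i, 0)) * e_fun (- int k) z)" for z
    using * g by (intro sum.mono_neutral_right) (auto simp: first_column_const_def)
  then show ?thesis
    by (simp add: u_def[abs_def])
qed

lemma first_column_const_iff_u:
  "first_column_const \<longleftrightarrow> (\<forall>i<N. \<exists>c. L2_eq (u i) (\<lambda>z. c * e_fun 0 z))"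
proof
  assume "first_column_const"
  then show "\<forall>i<N. \<exists>c. L2_eq (u i) (\<lambda>z. c * e_fun 0 z)"
    using u_const by (auto simp: L2_eq_def)
next
  assume R: "\<forall>i<N. \<exists>c. L2_eq (u i) (\<lambda>z. c * e_fun 0 z)"
  show "first_column_const"
    unfolding first_column_const_def
  proof (intro allI impI ballI)
    fix i k assume i: "i < N" and k: "k \<in> {1..<g}"
    obtain c where c: "L2_eq (u i) (\<lambda>z. c * e_fun 0 z)"
      using R i by blast
    \<comment> \<open>The frequency \<open>- k\<close> is nonzero, so a multiple of
      \<open>e_fun 0\<close> has no such coefficient, while that of \<open>u i\<close> is the
      conjugate of \<open>Ac k $$ (i, 0)\<close>.\<close>
    have "ip (u i) (e_fun (- int k)) = ip (\<lambda>z. c * e_fun 0 z) (e_fun (- int k))"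
      by (intro ip_cong_AE c u_L2 L2_scale L2_e_fun)
    also have "\<dots> = 0"
      using k by (simp add: ip_scale_left ip_e_fun)
    finally have "ip (e_fun (- int k)) (u i) = 0"
      by (simp add: ip_commute[of "e_fun (- int k)"])
    then show "Ac k $$ (i, 0) = 0"
      using k by (simp add: ip_e_fun_u)
  qed
qed

lemma first_column_const_iff:
  "first_column_const \<longleftrightarrow> (\<forall>z\<in>circle. \<forall>i<N. A z $$ (i, 0) = A 1 $$ (i, 0))"
proof
  assume *: "first_column_const"
  have "A z $$ (i, 0) = Ac 0 $$ (i, 0)" if "z \<in> circle" "i < N" for z i
  proof -
    have "cnj (A z $$ (i, 0)) = cnj (Ac 0 $$ (i, 0))"
      using u_eq[OF that] u_const[OF * that(2)] by (simp add: e_fun_def)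
    then show ?thesis
      by simp
  qed
  then show "\<forall>z\<in>circle. \<forall>i<N. A z $$ (i, 0) = A 1 $$ (i, 0)"
    by simp
next
  assume *: "\<forall>z\<in>circle. \<forall>i<N. A z $$ (i, 0) = A 1 $$ (i, 0)"
  \<comment> \<open>Pointwise constancy on the circle is passed to \<open>u i\<close>, whose Fourier
    coefficients then yield the vanishing of the higher \<open>Ac k $$ (i, 0)\<close>.\<close>
  have "L2_eq (u i) (\<lambda>z. cnj (A 1 $$ (i, 0)) * e_fun 0 z)" if "i < N" for i
    unfolding L2_eq_def
  proof (rule AE_I2)
    fix z assume "z \<in> space haar"
    then have z: "z \<in> circle"
      by simp
    then have "A z $$ (i, 0) = A 1 $$ (i, 0)"
      using * that by blast
    then show "u i z = cnj (A 1 $$ (i, 0)) * e_fun 0 z"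
      unfolding u_eq[OF z that] by (simp only: e_fun_def power_int_0_right mult_1_right)
  qed
  then show "first_column_const"
    unfolding first_column_const_iff_u by blast
qed

lemma ip_u_u: "ip (u i) (u i) = of_real (\<Sum>k<g. (cmod (Ac k $$ (i, 0)))\<^sup>2)"
proof -
  have "ip (u i) (u i) = (\<Sum>k<g. cnj (Ac k $$ (i, 0)) * ip (e_fun (- int k)) (u i))"
    by (subst (1) u_def[abs_def], subst ip_sum_left)
      (auto simp: ip_scale_left intro: L2_scale L2_e_fun u_L2)
  also have "\<dots> = (\<Sum>k<g. of_real ((cmod (Ac k $$ (i, 0)))\<^sup>2))"
    by (intro sum.cong) (auto simp: ip_e_fun_u complex_norm_square mult.commute simp del: of_real_power)
  finally show ?thesis
    by simp
qed

text \<open>Parseval for the first column, which has norm \<open>1\<close> at every point of the circle.\<close>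

lemma sum_coeff_norms: "(\<Sum>i<N. \<Sum>k<g. (cmod (Ac k $$ (i, 0)))\<^sup>2) = 1"
proof -
  have "(\<Sum>i<N. ip (u i) (u i)) = (LINT z|haar. (\<Sum>i<N. u i z * cnj (u i z)))"
    by (simp add: ip_def ip_integrable u_L2)
  also have "\<dots> = (LINT z|haar. z ^ 0)"
  proof (rule Bochner_Integration.integral_cong)
    fix z assume "z \<in> space haar"
    then have z: "z \<in> circle"
      by simp
    have "(\<Sum>i<N. u i z * cnj (u i z)) = (\<Sum>i<N. cnj (A z $$ (i, 0)) * A z $$ (i, 0))"
      by (intro sum.cong) (simp_all add: u_eq[OF z])
    also have "\<dots> = 1"
      using poly_loop_unitary[OF loop z] N unfolding unitary_group_iff by auto
    finally show "(\<Sum>i<N. u i z * cnj (u i z)) = z ^ 0"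
      by simp
  qed simp
  also have "\<dots> = 1"
    by (subst integral_haar_power) simp
  finally have "complex_of_real (\<Sum>i<N. \<Sum>k<g. (cmod (Ac k $$ (i, 0)))\<^sup>2) = of_real 1"
    by (simp add: ip_u_u)
  then show ?thesis
    unfolding of_real_eq_iff .
qed

text \<open>The matrix entry is the share of \<open>Ac 0\<close> in a total square norm of 1. It
  equals 1 exactly when the nonnegative remainder from \<open>k \<ge> 1\<close> is zero, that is,
  when each of its terms is.\<close>

lemma first_column_const_iff_lambda0:
  "first_column_const \<longleftrightarrow> (mat_adjoint (Ac 0) * Ac 0) $$ (0, 0) = 1"
proof -
  have c: "Ac 0 \<in> carrier_mat N N"
    using coeff_carrier g by simp
  have "(mat_adjoint (Ac 0) * Ac 0) $$ (0, 0) = (\<Sum>i<N. mat_adjoint (Ac 0) $$ (0, i) * Ac 0 $$ (i, 0))"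
    using N by (intro mult_mat_index[OF mat_adjoint_carrier[OF c] c]) auto
  also have "\<dots> = (\<Sum>i<N. of_real ((cmod (Ac 0 $$ (i, 0)))\<^sup>2))"
    using c N by (intro sum.cong) (auto simp: mat_adjoint_index conjugate_complex_def complex_norm_square mult.commute
        simp del: of_real_power)
  finally have "(mat_adjoint (Ac 0) * Ac 0) $$ (0, 0) = 1 \<longleftrightarrow> (\<Sum>i<N. (cmod (Ac 0 $$ (i, 0)))\<^sup>2) = 1"
    by (simp flip: of_real_sum del: of_real_power)
  moreover have "(\<Sum>k<g. (cmod (Ac k $$ (i, 0)))\<^sup>2) =
      (cmod (Ac 0 $$ (i, 0)))\<^sup>2 + (\<Sum>k\<in>{1..<g}. (cmod (Ac k $$ (i, 0)))\<^sup>2)" for i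
    using g by (simp add: lessThan_atLeast0 sum.atLeast_Suc_lessThan)
  then have "(\<Sum>i<N. (cmod (Ac 0 $$ (i, 0)))\<^sup>2) + (\<Sum>i<N. \<Sum>k\<in>{1..<g}. (cmod (Ac k $$ (i, 0)))\<^sup>2) = 1"
    using sum_coeff_norms by (simp add: sum.distrib)
  moreover have "(\<Sum>i<N. \<Sum>k\<in>{1..<g}. (cmod (Ac k $$ (i, 0)))\<^sup>2) = 0 \<longleftrightarrow> first_column_const"
    unfolding first_column_const_def by (auto simp: sum_nonneg_eq_0_iff sum_nonneg)
  ultimately show ?thesis
    by linarith
qed

lemma ip_T_op_u: "i < N \<Longrightarrow> h \<in> L2 \<Longrightarrow> ip (T_op N A i h) (e_fun 0) = ip h (u i)"
  by (subst ip_T_op_one[OF loop]) (auto simp: u_eq intro!: ip_cong)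

text \<open>The chosen adjoint value agrees with \<open>u i\<close> almost everywhere, so the
  criterion for \<open>u i\<close> carries over.\<close>

lemma first_column_const_iff_adjoint:
  "first_column_const \<longleftrightarrow> (\<forall>i<N. \<exists>c. L2_eq (adj_on L2 (T_op N A i) (e_fun 0)) (\<lambda>z. c * e_fun 0 z))"
proof -
  have "L2_eq (adj_on L2 (T_op N A i) (e_fun 0)) (u i)" if "i < N" for i
    by (rule adj_on_L2[OF u_L2 ip_T_op_u[OF that]])
  then have "L2_eq (adj_on L2 (T_op N A i) (e_fun 0)) f \<longleftrightarrow> L2_eq (u i) f" if "i < N" for i f
    using that unfolding L2_eq_def by (fastforce elim: AE_mp)
  then show ?thesis
    unfolding first_column_const_iff_u by simp
qed

section \<open>Compression to \<open>K_space\<close> and condition (v)\<close>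

abbreviation I :: "int set" where
  "I \<equiv> {- int (g + (g - 1) div (N - 1))..0}"

text \<open>The frequencies \<open>- k\<close> with \<open>k < g\<close> lie in \<open>I\<close>.
  Hence \<open>u i\<close> can also represent the adjoint of the compressed operator.\<close>

lemma u_in_K: "u i \<in> K_space N g"
  unfolding K_space_def u_def[abs_def]
  by (intro span_e_sum span_e_scale e_fun_in_span_e) auto

lemma E00_eq: "f \<in> L2 \<Longrightarrow> E00 f = (\<lambda>z. ip f (e_fun 0) * e_fun 0 z)"
  unfolding E00_def by (subst proj_on_span_e) auto

lemma V_op_eq:
  "i < N \<Longrightarrow> h \<in> L2 \<Longrightarrow> V_op N g A i h = (\<lambda>z. \<Sum>n\<in>I. ip (T_op N A i h) (e_fun n) * e_fun n z)"
  unfolding V_op_def K_space_def by (rule proj_on_span_e) (auto intro: T_op_L2[OF loop])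

lemma V_op_L2: "i < N \<Longrightarrow> h \<in> L2 \<Longrightarrow> V_op N g A i h \<in> L2"
  by (simp add: V_op_eq L2_trig_sum)

text \<open>Projecting to \<open>K_space\<close> keeps the coefficient at frequency 0, so
  \<open>V_op\<close> inherits this value from \<open>T_op\<close>.\<close>

lemma ip_V_op: "i < N \<Longrightarrow> h \<in> L2 \<Longrightarrow> ip (V_op N g A i h) (e_fun 0) = ip h (u i)"
  by (simp add: V_op_eq ip_trig_sum_e_fun ip_T_op_u)

lemma K_L2: "h \<in> K_space N g \<Longrightarrow> h \<in> L2"
  unfolding K_space_def by (rule span_e_subset_L2)

text \<open>Multiples of \<open>e_fun 0\<close> are allowed because these are the values of
  \<open>E00\<close> on \<open>L2\<close>.\<close>

lemma adj_V_op:
  assumes "i < N"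
  shows "adj_on (K_space N g) (V_op N g A i) (\<lambda>z. c * e_fun 0 z) = (\<lambda>z. c * u i z)"
  unfolding K_space_def
proof (rule adj_on_span_e)
  show "(\<lambda>z. c * u i z) \<in> span_e I"
    using span_e_scale[OF u_in_K[unfolded K_space_def]] .
  fix h assume "h \<in> span_e I"
  then show "ip (V_op N g A i h) (\<lambda>z. c * e_fun 0 z) = ip h (\<lambda>z. c * u i z)"
    using assms by (simp add: ip_scale_right ip_V_op span_e_subset_L2)
qed simp

text \<open>In each summand \<open>E00\<close> extracts the coefficient of
  \<open>V_op N g A i \<xi>\<close> at 0, and the adjoint turns \<open>e_fun 0\<close> into
  \<open>u i\<close>. The result is a sum of positive rank-one operators.\<close>

lemma sigma_adj_E00:
  assumes "\<xi> \<in> K_space N g"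
  shows "sigma_adj N g A E00 \<xi> = (\<lambda>z. \<Sum>i<N. ip \<xi> (u i) * u i z)"
  unfolding sigma_adj_def
  by (rule ext, rule sum.cong)
    (simp_all add: E00_eq V_op_L2 K_L2[OF assms] ip_V_op adj_V_op)

text \<open>For the converse, \<open>E00\<close> kills \<open>e_fun (- int k)\<close> when
  \<open>k > 0\<close>, so the quadratic form of the positive operator vanishes there and every
  summand must vanish.\<close>

lemma first_column_const_iff_sigma:
  "first_column_const \<longleftrightarrow>
    (\<exists>c. \<forall>\<xi>\<in>K_space N g. L2_eq (sigma_adj N g A E00 \<xi>) (\<lambda>z. c * E00 \<xi> z))"
proof
  assume *: "first_column_const"
  define a where "a i = Ac 0 $$ (i, 0)" for i
  have "sigma_adj N g A E00 \<xi> = (\<lambda>z. (\<Sum>i<N. a i * cnj (a i)) * E00 \<xi> z)" if "\<xi> \<in> K_space N g" for \<xi>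
    unfolding sigma_adj_E00[OF that] E00_eq[OF K_L2[OF that]] sum_distrib_right
    by (rule ext, rule sum.cong) (simp_all add: u_const[OF *] ip_scale_right a_def)
  then show "\<exists>c. \<forall>\<xi>\<in>K_space N g. L2_eq (sigma_adj N g A E00 \<xi>) (\<lambda>z. c * E00 \<xi> z)"
    \<comment> \<open>The scalar is the squared norm of column 0 of \<open>Ac 0\<close>, which is
      the quantity in (i).\<close>
    by (intro exI[of _ "\<Sum>i<N. a i * cnj (a i)"]) (simp add: L2_eq_def)
next
  assume "\<exists>c. \<forall>\<xi>\<in>K_space N g. L2_eq (sigma_adj N g A E00 \<xi>) (\<lambda>z. c * E00 \<xi> z)"
  then obtain c where c: "\<And>\<xi>. \<xi> \<in> K_space N g \<Longrightarrow> L2_eq (sigma_adj N g A E00 \<xi>) (\<lambda>z. c * E00 \<xi> z)"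
    by blast
  show "first_column_const"
    unfolding first_column_const_def
  proof (intro allI impI ballI)
    fix i k assume i: "i < N" and k: "k \<in> {1..<g}"
    define e where "e = e_fun (- int k)"
    have e: "e \<in> K_space N g"
      unfolding e_def K_space_def using k by (intro e_fun_in_span_e) auto
    have s: "sigma_adj N g A E00 e = (\<lambda>z. \<Sum>i<N. ip e (u i) * u i z)"
      by (rule sigma_adj_E00[OF e])
    have s_L2: "sigma_adj N g A E00 e \<in> L2"
      unfolding s by (intro L2_sum L2_scale u_L2)
    have E: "E00 e = (\<lambda>z. 0)"
      unfolding E00_eq[OF K_L2[OF e]] using k by (simp add: e_def ip_e_fun)
    have "ip (sigma_adj N g A E00 e) e = ip (\<lambda>z. c * E00 e z) e"
      using L2_const[of 0] by (intro ip_cong_AE[OF c[OF e] s_L2 _ K_L2[OF e]]) (simp add: E)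
    also have "\<dots> = 0"
      by (simp add: E ip_def)
    finally have "ip (sigma_adj N g A E00 e) e = 0" .
    moreover have "ip (sigma_adj N g A E00 e) e = (\<Sum>i<N. ip e (u i) * ip (u i) e)"
      unfolding s by (subst ip_sum_left) (auto simp: ip_scale_left intro: L2_scale u_L2 K_L2[OF e])
    \<comment> \<open>The two factors are conjugate to each other, so the form is a sum of squared
      moduli.\<close>
    moreover have "\<dots> = of_real (\<Sum>i<N. (cmod (ip e (u i)))\<^sup>2)"
      unfolding of_real_sum by (intro sum.cong refl) (metis ip_commute complex_norm_square of_real_power)
    ultimately have "(\<Sum>i<N. (cmod (ip e (u i)))\<^sup>2) = 0"
      by (simp only: of_real_eq_0_iff)
    then have "ip e (u i) = 0"
      using i by (simp add: sum_nonneg_eq_0_iff)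
    then show "Ac k $$ (i, 0) = 0"
      using k by (simp add: e_def ip_e_fun_u)
  qed
qed

end

theorem theorem6p2:
  fixes N g :: nat
    and A :: "complex \<Rightarrow> complex mat"
    and Ac :: "nat \<Rightarrow> complex mat"
  assumes "N \<ge> 2" and "g \<ge> 1"
    and "A \<in> poly_loops N"
    and "\<And>k. k < g \<Longrightarrow> Ac k \<in> carrier_mat N N"
    and "\<And>z. z \<in> circle \<Longrightarrow> A z = mat N N (\<lambda>(i, j). \<Sum>k<g. z ^ k * Ac k $$ (i, j))"
  shows
    "let
       cond_i = ((mat_adjoint (Ac 0) * Ac 0) $$ (0, 0) = 1);
       cond_ii = (\<exists>B \<in> poly_loops (N - 1). \<forall>z \<in> circle.
          the (mat_inverse (A 1)) * A z =
            four_block_mat (1\<^sub>m 1) (0\<^sub>m 1 (N - 1)) (0\<^sub>m (N - 1) 1) (B z));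
       cond_iii = (\<exists>W \<in> unitary_group N. \<exists>B \<in> poly_loops (N - 1).
          let m = (\<lambda>i z. \<Sum>j<N. W $$ (i, j) * wavelet_filter N A j z) in
            (\<forall>z \<in> circle. m 0 z = 1) \<and>
            (\<forall>i \<in> {1..N - 1}. \<forall>z \<in> circle.
               m i z = (\<Sum>j = 1..N - 1. B (z ^ N) $$ (i - 1, j - 1) * z ^ j)));
       cond_iv = (\<forall>i<N. \<exists>c. L2_eq (adj_on L2 (T_op N A i) (e_fun 0)) (\<lambda>z. c * e_fun 0 z));
       cond_v = (\<exists>c. \<forall>\<xi> \<in> K_space N g. L2_eq (sigma_adj N g A E00 \<xi>) (\<lambda>z. c * E00 \<xi> z))
     in (cond_i \<longleftrightarrow> cond_ii) \<and> (cond_ii \<longleftrightarrow> cond_iii) \<and> (cond_iii \<longleftrightarrow> cond_iv) \<and>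
        (cond_iv \<longleftrightarrow> cond_v)"
proof -
  interpret polynomial_loop N g A Ac
    using assms by unfold_locales auto
  note iii = filter_form_iff_first_column_const[OF N loop, folded first_column_const_iff]
  show ?thesis
    \<comment> \<open>Each of the five conditions is rewritten to \<open>first_column_const\<close>,
      which makes the chain of equivalences trivial.\<close>
    unfolding iii[unfolded Let_def] Let_def splits_iff_first_column_const[OF N loop]
      first_column_const_iff_lambda0[symmetric] first_column_const_iff[symmetric]
      first_column_const_iff_adjoint[symmetric] first_column_const_iff_sigma[symmetric]
    by simp
qed

end
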